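(* Let $n\geq 1$ and let $X_1,X_2,\ldots,X_n$ be non-degenerate independent random variables taking values in a measurable space $(F,\mathcal{F})$. Fix a point $\partial\notin F$. Let $S$ and $T$ be two random subsets of $[n]=\{1,2,\ldots,n\}$ such that the pair $(S,T)$ is independent of $(X_1,X_2,\ldots,X_n)$. For $i=1,\ldots,n$ define $Y_i=X_i$ if $i\in S$ and $Y_i=\partial$ otherwise; and $Z_i=X_i$ if $i\in T$ and $Z_i=\partial$ otherwise. Then \[R\big((Y_1,Y_2,\ldots,Y_n),(Z_1,Z_2,\ldots,Z_n)\big)=\max\big(R(S,T),\max(r_j:j\in[n])\big),\] where $r_j$ is the best (smallest) constant $r\ge 0$ for which \[\sum_{s,t\subset[n]:\,j\in s\cap t}P(S=s,T=t)\,\alpha_s\beta_t\leq r\sqrt{\sum_{s\subset[n]:\,j\in s}P(S=s)\alpha_s^2}\,\sqrt{\sum_{t\subset[n]:\,j\in t}P(T=t)\beta_t^2}\] holds for all real numbers $\alpha_s,\beta_t$. In particular, when $S$ and $T$ are independent, $R(S,T)=0$ and $r_{j}=\sqrt{P(j\in S)P(j\in T)}$ for every $j\in[n]$.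
   Context: For two random elements $X,Y$ (defined on a common probability space, with values in arbitrary measurable spaces), the maximal correlation coefficient is $R(X,Y)=\sup \rho(\varphi(X),\psi(Y))$, where $\rho$ denotes the Pearson correlation coefficient and the supremum is over all real-valued measurable functions $\varphi,\psi$ such that $\varphi(X)$ and $\psi(Y)$ are square-integrable with positive variance. A random element $X$ is degenerate if every real-valued measurable function of it is almost surely constant, and non-degenerate otherwise (equivalently, there is a measurable set $A$ with $0<P(X\in A)<1$). If $X$ or $Y$ is degenerate, one sets $R(X,Y)=0$. The space $F\cup\{\partial\}$ carries the $\sigma$-field generated by $\mathcal{F}$ and $\{\partial\}$; random subsets of $[n]$ are random elements of the finite set of all subsets of $[n]$. *)

theory Defs
  imports "HOL-Probability.Probability"
begin

text \<open>A random element of a measurable space \<open>A\<close> is a measurable map from a probability space \<open>M\<close>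
  to \<open>A\<close>. Only \<open>space A\<close> and \<open>sets A\<close> matter; the measure carried by \<open>A\<close> is never used.\<close>

definition pearson_corr :: "'w measure \<Rightarrow> ('w \<Rightarrow> real) \<Rightarrow> ('w \<Rightarrow> real) \<Rightarrow> real" where
  "pearson_corr M f g =
     prob_space.expectation M
       (\<lambda>\<omega>. (f \<omega> - prob_space.expectation M f) * (g \<omega> - prob_space.expectation M g)) /
     (sqrt (prob_space.variance M f) * sqrt (prob_space.variance M g))"

definition degenerate :: "'w measure \<Rightarrow> 'a measure \<Rightarrow> ('w \<Rightarrow> 'a) \<Rightarrow> bool" where
  "degenerate M A U \<longleftrightarrow> (\<forall>\<phi>\<in>borel_measurable A. \<exists>c::real. AE \<omega> in M. \<phi> (U \<omega>) = c)"

definition max_corr ::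
    "'w measure \<Rightarrow> 'a measure \<Rightarrow> ('w \<Rightarrow> 'a) \<Rightarrow> 'b measure \<Rightarrow> ('w \<Rightarrow> 'b) \<Rightarrow> real" where
  "max_corr M A U B V =
     (if degenerate M A U \<or> degenerate M B V then 0
      else Sup {pearson_corr M (\<lambda>\<omega>. \<phi> (U \<omega>)) (\<lambda>\<omega>. \<psi> (V \<omega>)) | \<phi> \<psi>.
                  \<phi> \<in> borel_measurable A \<and> \<psi> \<in> borel_measurable B \<and>
                  integrable M (\<lambda>\<omega>. (\<phi> (U \<omega>))\<^sup>2) \<and> integrable M (\<lambda>\<omega>. (\<psi> (V \<omega>))\<^sup>2) \<and>
                  0 < prob_space.variance M (\<lambda>\<omega>. \<phi> (U \<omega>)) \<and>
                  0 < prob_space.variance M (\<lambda>\<omega>. \<psi> (V \<omega>))})"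

text \<open>The library's \<open>indep_var\<close> forces both random elements to have values in the same type.
  The following removes that restriction.\<close>

definition indep_elements ::
    "'w measure \<Rightarrow> 'a measure \<Rightarrow> ('w \<Rightarrow> 'a) \<Rightarrow> 'b measure \<Rightarrow> ('w \<Rightarrow> 'b) \<Rightarrow> bool" where
  "indep_elements M A U B V \<longleftrightarrow>
     U \<in> measurable M A \<and> V \<in> measurable M B \<and>
     prob_space.indep_set M {U -` E \<inter> space M | E. E \<in> sets A} {V -` E \<inter> space M | E. E \<in> sets B}"

lemma indep_elements_iff_indep_var:
  fixes M :: "'w measure" and A B :: "'b measure"
  assumes "prob_space M"
  shows "indep_elements M A U B V \<longleftrightarrow> prob_space.indep_var M A U B V"
proof -
  interpret prob_space M by fact
  have gen: "sigma_sets (space M) {X -` E \<inter> space M | E. E \<in> sets N} = {X -` E \<inter> space M | E. E \<in> sets N}"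
    if "X \<in> measurable M N" for X :: "'w \<Rightarrow> 'b" and N
  proof -
    have "sets (vimage_algebra (space M) X N) = {X -` E \<inter> space M | E. E \<in> sets N}"
      using measurable_space[OF that] by (intro sets_vimage_algebra2) auto
    then show ?thesis
      using sets.sigma_sets_eq[of "vimage_algebra (space M) X N"] by simp
  qed
  show ?thesis
    by (auto simp: indep_elements_def indep_var_eq gen)
qed

text \<open>The space \<open>F \<union> {\<partial>}\<close> with the \<open>\<sigma>\<close>-field generated by the measurable sets of \<open>F\<close>
  and \<open>{\<partial>}\<close>. The extra point \<open>\<partial>\<close> is \<open>None\<close>, and \<open>F\<close> is identified with its image under \<open>Some\<close>.\<close>

definition add_point :: "'a measure \<Rightarrow> 'a option measure" where
  "add_point F = sigma (insert None (Some ` space F)) (insert {None} ((\<lambda>A. Some ` A) ` sets F))"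

definition subset_space :: "nat \<Rightarrow> nat set measure" where
  "subset_space n = count_space (Pow {1..n})"

text \<open>The smallest constant always exists: by Cauchy-Schwarz the value 1 is admissible, and the
  admissible constants form a closed subset of \<open>[0, \<infinity>)\<close>.\<close>

definition best_const ::
    "'w measure \<Rightarrow> nat \<Rightarrow> ('w \<Rightarrow> nat set) \<Rightarrow> ('w \<Rightarrow> nat set) \<Rightarrow> nat \<Rightarrow> real" where
  "best_const M n S T j =
     (LEAST r::real. 0 \<le> r \<and>
        (\<forall>\<alpha> \<beta> :: nat set \<Rightarrow> real.
           (\<Sum>(s, t) | s \<subseteq> {1..n} \<and> t \<subseteq> {1..n} \<and> j \<in> s \<inter> t.
              measure M {\<omega> \<in> space M. S \<omega> = s \<and> T \<omega> = t} * \<alpha> s * \<beta> t)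
           \<le> r * sqrt (\<Sum>s | s \<subseteq> {1..n} \<and> j \<in> s. measure M {\<omega> \<in> space M. S \<omega> = s} * (\<alpha> s)\<^sup>2)
               * sqrt (\<Sum>t | t \<subseteq> {1..n} \<and> j \<in> t. measure M {\<omega> \<in> space M. T \<omega> = t} * (\<beta> t)\<^sup>2)))"

end

theory Submission
  imports Defs
begin

text \<open>
  Conditioning on \<open>(S, T)\<close> splits the covariance of \<open>\<phi>(Y) = h\<^sub>S(X)\<close> and \<open>\<psi>(Z) = g\<^sub>T(X)\<close> into the
  covariance of the conditional means, two functions of \<open>S\<close> and of \<open>T\<close>, and
  \<open>\<Sum> P(S = s, T = t) Cov(h\<^sub>s(X), g\<^sub>t(X))\<close>. Integrating out the independent coordinates one at a time, the
  law of total covariance turns the second part into a sum over \<open>j\<close> of integrals of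
  \<open>\<Sum> P(S = s, T = t) D\<^sub>s D'\<^sub>t\<close>, where the martingale differences \<open>D\<^sub>s\<close>, \<open>D'\<^sub>t\<close> vanish unless
  \<open>j \<in> s\<close> and \<open>j \<in> t\<close>. The inequality defining \<open>r\<^sub>j\<close> applies pointwise to them, and
  Cauchy-Schwarz puts the parts together. Conversely, \<open>S\<close> and \<open>T\<close> are functions of \<open>Y\<close> and \<open>Z\<close>,
  and the test functions \<open>\<alpha>\<^sub>S \<xi>(X\<^sub>j)\<close>, \<open>\<beta>\<^sub>T \<xi>(X\<^sub>j)\<close> with \<open>\<xi>(X\<^sub>j)\<close> centered and non-constant yield the
  inequality defining \<open>r\<^sub>j\<close>.
\<close>

section \<open>Covariances and maximal correlation\<close>

text \<open>By independence of \<open>(S, T)\<close> and \<open>X\<close>, the law of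
  \<open>X\<close> given \<open>(S, T) = (s, t)\<close> is the same for all \<open>s\<close> and
  \<open>t\<close>. So the conditional means depend on the sets alone, and what remains is a
  covariance of fixed functions of \<open>X\<close>. A residual along the coordinate
  \<open>j\<close> vanishes unless \<open>j\<close> lies in the set because masking hides
  \<open>x j\<close>, and averaging over other coordinates preserves this. Residuals along different
  coordinates are orthogonal, so no mixed terms arise: each part is bounded separately with one
  common constant, and Cauchy-Schwarz in the plane adds such bounds without loss. This is why a
  maximum appears and not a sum. In the converse direction, centering \<open>\<xi>\<close> removes
  the conditional means, and its variance factors out of both sides. Bounds are stated for
  \<open>cov\<close> instead of correlations: unlike quotients, they can be added, and they make
  sense when a variance is 0.\<close>

definition sqint :: "'a measure \<Rightarrow> ('a \<Rightarrow> real) \<Rightarrow> bool" where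
  "sqint M f \<longleftrightarrow> f \<in> borel_measurable M \<and> integrable M (\<lambda>x. (f x)\<^sup>2)"

text \<open>The uncentered form is made of plain moments, on which Fubini and conditioning act term
  by term. \<open>centered_eq_cov\<close> links it to the centered moments in
  \<open>pearson_corr\<close>.\<close>

definition cov :: "'a measure \<Rightarrow> ('a \<Rightarrow> real) \<Rightarrow> ('a \<Rightarrow> real) \<Rightarrow> real" where
  "cov M f g = (\<integral>x. f x * g x \<partial>M) - (\<integral>x. f x \<partial>M) * (\<integral>x. g x \<partial>M)"

lemma sqint_measurable[measurable_dest]: "sqint M f \<Longrightarrow> f \<in> borel_measurable M"
  by (simp add: sqint_def)

lemma sqint_mult_integrable:
  assumes f: "sqint M f" and g: "sqint M g"
  shows "integrable M (\<lambda>x. f x * g x)"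
proof (rule Bochner_Integration.integrable_bound)
  show "integrable M (\<lambda>x. (f x)\<^sup>2 + (g x)\<^sup>2)"
    using f g by (simp add: sqint_def)
  show "(\<lambda>x. f x * g x) \<in> borel_measurable M"
    using f g by (auto simp: sqint_def)
  have "\<bar>a * b\<bar> \<le> a\<^sup>2 + b\<^sup>2" for a b :: real
  proof -
    have "0 \<le> \<bar>a\<bar> * \<bar>b\<bar>"
      by simp
    with sum_squares_bound[of "\<bar>a\<bar>" "\<bar>b\<bar>"] show ?thesis
      unfolding abs_mult power2_abs by linarith
  qed
  then show "AE x in M. norm (f x * g x) \<le> norm ((f x)\<^sup>2 + (g x)\<^sup>2)"
    by auto
qed

lemma sqint_add:
  assumes f: "sqint M f" and g: "sqint M g"
  shows "sqint M (\<lambda>x. f x + g x)"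
proof -
  have "integrable M (\<lambda>x. (f x)\<^sup>2 + (g x)\<^sup>2 + 2 * (f x * g x))"
    using f g sqint_mult_integrable[OF f g] by (simp add: sqint_def)
  then have "integrable M (\<lambda>x. (f x + g x)\<^sup>2)"
    by (simp add: power2_sum mult.assoc)
  then show ?thesis
    using f g by (auto simp: sqint_def)
qed

lemma sqint_cmult: "sqint M f \<Longrightarrow> sqint M (\<lambda>x. c * f x)"
  by (auto simp: sqint_def power_mult_distrib)

lemma sqint_diff:
  assumes f: "sqint M f" and g: "sqint M g"
  shows "sqint M (\<lambda>x. f x - g x)"
  using sqint_add[OF f sqint_cmult[OF g, of "-1"]] by simp

lemma cov_cong:
  assumes "\<And>x. x \<in> space M \<Longrightarrow> f x = f' x" "\<And>x. x \<in> space M \<Longrightarrow> g x = g' x"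
  shows "cov M f g = cov M f' g'"
  unfolding cov_def using assms by (simp cong: Bochner_Integration.integral_cong)

lemma sqint_cong:
  assumes "\<And>x. x \<in> space M \<Longrightarrow> f x = f' x"
  shows "sqint M f \<longleftrightarrow> sqint M f'"
  unfolding sqint_def using assms
  by (simp cong: Bochner_Integration.integrable_cong measurable_cong)

lemma cov_cong_AE:
  assumes [measurable]: "f \<in> borel_measurable M" "f' \<in> borel_measurable M"
      "g \<in> borel_measurable M" "g' \<in> borel_measurable M"
    and f: "AE x in M. f x = f' x" and g: "AE x in M. g x = g' x"
  shows "cov M f g = cov M f' g'"
proof -
  have "AE x in M. f x * g x = f' x * g' x"
    using f g by eventually_elim simp
  then have "(\<integral>x. f x * g x \<partial>M) = (\<integral>x. f' x * g' x \<partial>M)"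
    by (intro integral_cong_AE) auto
  moreover have "(\<integral>x. f x \<partial>M) = (\<integral>x. f' x \<partial>M)" "(\<integral>x. g x \<partial>M) = (\<integral>x. g' x \<partial>M)"
    using f g by (auto intro!: integral_cong_AE)
  ultimately show ?thesis
    by (simp add: cov_def)
qed

lemma integral_Cauchy_Schwarz:
  assumes f: "sqint M f" and g: "sqint M g"
  shows "(\<integral>x. f x * g x \<partial>M)\<^sup>2 \<le> (\<integral>x. (f x)\<^sup>2 \<partial>M) * (\<integral>x. (g x)\<^sup>2 \<partial>M)"
proof -
  define a b c where "a = (\<integral>x. (f x)\<^sup>2 \<partial>M)" and "b = (\<integral>x. (g x)\<^sup>2 \<partial>M)"
    and "c = (\<integral>x. f x * g x \<partial>M)"
  have [simp]: "integrable M (\<lambda>x. (f x)\<^sup>2)" "integrable M (\<lambda>x. (g x)\<^sup>2)"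
    "integrable M (\<lambda>x. f x * g x)"
    using f g sqint_mult_integrable[OF f g] by (simp_all add: sqint_def)
  have [measurable]: "g \<in> borel_measurable M"
    using g by (simp add: sqint_def)
  have b0: "b \<ge> 0"
    unfolding b_def by simp
  \<comment> \<open>The integral of \<open>(f - t * g)\<^sup>2\<close> is least at
    \<open>t = c / b\<close>. Multiplying through by \<open>b\<close> avoids the division, at the
    price of an extra factor \<open>b\<close> in the result; the case \<open>b = 0\<close>, where
    \<open>g\<close> vanishes almost everywhere, is settled separately.\<close>
  have "0 \<le> (\<integral>x. (b * f x - c * g x)\<^sup>2 \<partial>M)"
    by simp
  also have "\<dots> = (\<integral>x. b\<^sup>2 * (f x)\<^sup>2 + c\<^sup>2 * (g x)\<^sup>2 - 2 * b * c * (f x * g x) \<partial>M)"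
    by (intro Bochner_Integration.integral_cong) (auto simp: power2_eq_square algebra_simps)
  also have "\<dots> = b\<^sup>2 * a + c\<^sup>2 * b - 2 * b * c * c"
    by (simp add: a_def b_def c_def)
  also have "\<dots> = b * (a * b - c\<^sup>2)"
    by (simp add: power2_eq_square algebra_simps)
  finally have main: "0 \<le> b * (a * b - c\<^sup>2)" .
  show ?thesis
  proof (cases "b = 0")
    case True
    then have "AE x in M. (g x)\<^sup>2 = 0"
      unfolding b_def by (subst (asm) integral_nonneg_eq_0_iff_AE) auto
    then have "AE x in M. f x * g x = 0"
      by auto
    then have "c = 0"
      unfolding c_def by (rule integral_eq_zero_AE)
    then show ?thesis
      using b0 by (simp add: a_def[symmetric] b_def[symmetric] c_def[symmetric] True)
  next
    case False
    then have "0 \<le> a * b - c\<^sup>2"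
      using main b0 by (simp add: zero_le_mult_iff)
    then show ?thesis
      by (simp add: a_def b_def c_def)
  qed
qed

lemma integral_Cauchy_Schwarz_sqrt:
  assumes "sqint M f" and "sqint M g"
  shows "\<bar>\<integral>x. f x * g x \<partial>M\<bar> \<le> sqrt (\<integral>x. (f x)\<^sup>2 \<partial>M) * sqrt (\<integral>x. (g x)\<^sup>2 \<partial>M)"
  using real_sqrt_le_mono[OF integral_Cauchy_Schwarz[OF assms]] by (simp add: real_sqrt_mult)

text \<open>Cauchy-Schwarz for the roots of \<open>f\<close> and \<open>g\<close>. It takes a
  pointwise bound by a product of two roots of quadratic forms through the integral in
  \<open>weighted_cov_pair_le\<close>.\<close>

lemma integral_sqrt_mult_le:
  assumes [simp]: "integrable M f" "integrable M g"
    and nonneg: "\<And>x. x \<in> space M \<Longrightarrow> 0 \<le> f x" "\<And>x. x \<in> space M \<Longrightarrow> 0 \<le> g x"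
  shows "integrable M (\<lambda>x. sqrt (f x) * sqrt (g x))"
    and "(\<integral>x. sqrt (f x) * sqrt (g x) \<partial>M) \<le> sqrt (\<integral>x. f x \<partial>M) * sqrt (\<integral>x. g x \<partial>M)"
proof -
  have [simp]: "integrable M (\<lambda>x. (sqrt (f x))\<^sup>2)" "integrable M (\<lambda>x. (sqrt (g x))\<^sup>2)"
    using nonneg assms(1,2)
    by (simp_all cong: Bochner_Integration.integrable_cong)
  have [simp]: "(\<integral>x. (sqrt (f x))\<^sup>2 \<partial>M) = (\<integral>x. f x \<partial>M)"
    "(\<integral>x. (sqrt (g x))\<^sup>2 \<partial>M) = (\<integral>x. g x \<partial>M)"
    using nonneg
    by (auto intro!: Bochner_Integration.integral_cong)
  have *: "sqint M (\<lambda>x. sqrt (f x))" "sqint M (\<lambda>x. sqrt (g x))"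
    using borel_measurable_integrable[OF assms(1)] borel_measurable_integrable[OF assms(2)]
    by (simp_all add: sqint_def)
  show "integrable M (\<lambda>x. sqrt (f x) * sqrt (g x))"
    by (rule sqint_mult_integrable[OF *])
  show "(\<integral>x. sqrt (f x) * sqrt (g x) \<partial>M) \<le> sqrt (\<integral>x. f x \<partial>M) * sqrt (\<integral>x. g x \<partial>M)"
    using integral_Cauchy_Schwarz_sqrt[OF *] by simp
qed

text \<open>Cauchy-Schwarz in the plane for \<open>(sqrt a, sqrt c)\<close> and
  \<open>(sqrt b, sqrt d)\<close>; the square in the proof is the defect in Lagrange's identity. Two
  covariance bounds with the same constant can thus be added and keep that constant.\<close>

lemma sqrt_mult_add_le:
  assumes "0 \<le> a" "0 \<le> b" "0 \<le> c" "0 \<le> d"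
  shows "sqrt a * sqrt b + sqrt c * sqrt d \<le> sqrt (a + c) * sqrt (b + d)"
proof -
  have "0 \<le> (sqrt a * sqrt d - sqrt b * sqrt c)\<^sup>2"
    by simp
  then have "(sqrt a * sqrt b + sqrt c * sqrt d)\<^sup>2 \<le> (a + c) * (b + d)"
    using assms by (simp add: power2_sum power2_diff power_mult_distrib algebra_simps)
  then show ?thesis
    by (metis real_le_rsqrt real_sqrt_mult)
qed

section \<open>Second moments and non-degeneracy on a probability space\<close>

context prob_space
begin

lemma sqint_const: "sqint M (\<lambda>_. c)"
  by (simp add: sqint_def)

lemma sqint_integrable: "sqint M f \<Longrightarrow> integrable M f"
  using square_integrable_imp_integrable by (auto simp: sqint_def)

lemma sqint_bounded:
  assumes [measurable]: "f \<in> borel_measurable M" and "\<And>x. x \<in> space M \<Longrightarrow> \<bar>f x\<bar> \<le> B"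
  shows "sqint M f"
proof -
  have "(f x)\<^sup>2 \<le> B\<^sup>2" if "x \<in> space M" for x
    using assms(2)[OF that] by (metis abs_ge_zero order_trans power2_abs power_mono)
  then have "integrable M (\<lambda>x. (f x)\<^sup>2)"
    by (intro integrable_const_bound[where B="B\<^sup>2"]) auto
  then show ?thesis
    by (simp add: sqint_def)
qed

lemma expectation_square_le:
  assumes f: "sqint M f"
  shows "(expectation f)\<^sup>2 \<le> expectation (\<lambda>x. (f x)\<^sup>2)"
  using integral_Cauchy_Schwarz[OF f sqint_const[of 1]] by (simp add: prob_space)

lemma centered_eq_cov:
  assumes f: "sqint M f" and g: "sqint M g"
  shows "expectation (\<lambda>x. (f x - expectation f) * (g x - expectation g)) = cov M f g"
  using sqint_mult_integrable[OF f g] sqint_integrable[OF f] sqint_integrable[OF g]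
  by (simp add: cov_def algebra_simps prob_space)

lemma variance_eq_cov: "sqint M f \<Longrightarrow> variance f = cov M f f"
  using centered_eq_cov[of f f] by (simp add: power2_eq_square)

lemma cov_nonneg: "sqint M f \<Longrightarrow> 0 \<le> cov M f f"
  using variance_positive[of f] by (simp add: variance_eq_cov)

lemma cov_le_sqrt:
  assumes f: "sqint M f" and g: "sqint M g"
  shows "\<bar>cov M f g\<bar> \<le> sqrt (cov M f f) * sqrt (cov M g g)"
proof -
  have *: "sqint M (\<lambda>x. f x - expectation f)" "sqint M (\<lambda>x. g x - expectation g)"
    using f g by (auto intro: sqint_diff sqint_const)
  show ?thesis
    using integral_Cauchy_Schwarz_sqrt[OF *] f g by (simp add: centered_eq_cov variance_eq_cov)
qed

lemma cov_zero_imp_AE_const: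
  assumes f: "sqint M f" and "cov M f f = 0"
  shows "AE x in M. f x = expectation f"
proof -
  have [simp]: "integrable M (\<lambda>x. (f x - expectation f)\<^sup>2)"
    using sqint_diff[OF f sqint_const[of "expectation f"]] by (simp add: sqint_def)
  have "expectation (\<lambda>x. (f x - expectation f)\<^sup>2) = 0"
    using assms by (simp add: variance_eq_cov)
  then have "AE x in M. (f x - expectation f)\<^sup>2 = 0"
    by (subst (asm) integral_nonneg_eq_0_iff_AE) auto
  then show ?thesis
    by auto
qed

lemma AE_const_imp_cov_zero:
  assumes f: "sqint M f" and AE: "AE x in M. f x = c"
  shows "cov M f f = 0"
proof -
  have [measurable]: "f \<in> borel_measurable M"
    using f by (simp add: sqint_def)
  have "expectation f = expectation (\<lambda>_. c)"
    using AE by (intro integral_cong_AE) auto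
  moreover have "expectation (\<lambda>x. f x * f x) = expectation (\<lambda>_. c * c)"
    using AE by (intro integral_cong_AE) auto
  ultimately show ?thesis
    by (simp add: cov_def prob_space)
qed

lemma pearson_corr_eq_cov:
  assumes f: "sqint M f" and g: "sqint M g"
  shows "pearson_corr M f g = cov M f g / (sqrt (cov M f f) * sqrt (cov M g g))"
  using f g by (simp add: pearson_corr_def centered_eq_cov variance_eq_cov)

lemma nondegenerateD:
  assumes U: "U \<in> measurable M A" and nd: "\<not> degenerate M A U"
  obtains \<phi> where "\<phi> \<in> borel_measurable A"
    "sqint M (\<lambda>\<omega>. \<phi> (U \<omega>))" "0 < cov M (\<lambda>\<omega>. \<phi> (U \<omega>)) (\<lambda>\<omega>. \<phi> (U \<omega>))"
proof -
  obtain \<psi> where \<psi>[measurable]: "\<psi> \<in> borel_measurable A"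
    and no: "\<And>c::real. \<not> (AE \<omega> in M. \<psi> (U \<omega>) = c)"
    using nd by (auto simp: degenerate_def)
  note U[measurable]
  \<comment> \<open>composing with the bounded injection \<open>arctan\<close> gives integrability and keeps non-constancy\<close>
  define \<phi> where "\<phi> = (\<lambda>a. arctan (\<psi> a))"
  have "isCont arctan x" for x :: real
    by (rule isCont_arctan)
  then have [measurable]: "arctan \<in> borel_measurable borel"
    by (intro borel_measurable_continuous_onI continuous_at_imp_continuous_on) auto
  have \<phi>[measurable]: "\<phi> \<in> borel_measurable A"
    by (simp add: \<phi>_def)
  have bd: "\<bar>\<phi> a\<bar> \<le> 2" for a
    using arctan_bounded[of "\<psi> a"] pi_less_4 by (auto simp: \<phi>_def)
  have sq: "sqint M (\<lambda>\<omega>. \<phi> (U \<omega>))"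
    by (rule sqint_bounded[where B=2]) (auto intro: bd)
  have "cov M (\<lambda>\<omega>. \<phi> (U \<omega>)) (\<lambda>\<omega>. \<phi> (U \<omega>)) \<noteq> 0"
  proof
    assume "cov M (\<lambda>\<omega>. \<phi> (U \<omega>)) (\<lambda>\<omega>. \<phi> (U \<omega>)) = 0"
    from cov_zero_imp_AE_const[OF sq this]
    have "AE \<omega> in M. \<psi> (U \<omega>) = tan (expectation (\<lambda>\<omega>. \<phi> (U \<omega>)))"
      unfolding \<phi>_def by eventually_elim (metis tan_arctan)
    with no show False
      by blast
  qed
  with cov_nonneg[OF sq] have "0 < cov M (\<lambda>\<omega>. \<phi> (U \<omega>)) (\<lambda>\<omega>. \<phi> (U \<omega>))"
    by simp
  with \<phi> sq that show ?thesis
    by blast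
qed

lemma cov_pos_imp_nondegenerate:
  assumes "\<phi> \<in> borel_measurable A" "sqint M (\<lambda>\<omega>. \<phi> (U \<omega>))"
    and "0 < cov M (\<lambda>\<omega>. \<phi> (U \<omega>)) (\<lambda>\<omega>. \<phi> (U \<omega>))"
  shows "\<not> degenerate M A U"
proof
  assume "degenerate M A U"
  then obtain c where "AE \<omega> in M. \<phi> (U \<omega>) = c"
    using assms(1) by (auto simp: degenerate_def)
  from AE_const_imp_cov_zero[OF assms(2) this] assms(3) show False
    by simp
qed

section \<open>The maximal correlation as the least constant in a covariance inequality\<close>

context
  fixes A :: "'b measure" and B :: "'c measure" and U :: "'a \<Rightarrow> 'b" and V :: "'a \<Rightarrow> 'c"
  assumes U[measurable]: "U \<in> measurable M A" and V[measurable]: "V \<in> measurable M B"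
begin

lemma max_corr_set_eq:
  "{pearson_corr M (\<lambda>\<omega>. \<phi> (U \<omega>)) (\<lambda>\<omega>. \<psi> (V \<omega>)) | \<phi> \<psi>.
      \<phi> \<in> borel_measurable A \<and> \<psi> \<in> borel_measurable B \<and>
      integrable M (\<lambda>\<omega>. (\<phi> (U \<omega>))\<^sup>2) \<and> integrable M (\<lambda>\<omega>. (\<psi> (V \<omega>))\<^sup>2) \<and>
      0 < variance (\<lambda>\<omega>. \<phi> (U \<omega>)) \<and> 0 < variance (\<lambda>\<omega>. \<psi> (V \<omega>))} =
   {cov M (\<lambda>\<omega>. \<phi> (U \<omega>)) (\<lambda>\<omega>. \<psi> (V \<omega>)) /
      (sqrt (cov M (\<lambda>\<omega>. \<phi> (U \<omega>)) (\<lambda>\<omega>. \<phi> (U \<omega>))) * sqrt (cov M (\<lambda>\<omega>. \<psi> (V \<omega>)) (\<lambda>\<omega>. \<psi> (V \<omega>)))) | \<phi> \<psi>.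
      \<phi> \<in> borel_measurable A \<and> \<psi> \<in> borel_measurable B \<and>
      sqint M (\<lambda>\<omega>. \<phi> (U \<omega>)) \<and> sqint M (\<lambda>\<omega>. \<psi> (V \<omega>)) \<and>
      0 < cov M (\<lambda>\<omega>. \<phi> (U \<omega>)) (\<lambda>\<omega>. \<phi> (U \<omega>)) \<and>
      0 < cov M (\<lambda>\<omega>. \<psi> (V \<omega>)) (\<lambda>\<omega>. \<psi> (V \<omega>))}"
proof (intro Collect_cong iffI; elim exE conjE)
  fix x \<phi> \<psi>
  assume *: "x = pearson_corr M (\<lambda>\<omega>. \<phi> (U \<omega>)) (\<lambda>\<omega>. \<psi> (V \<omega>))"
    and [measurable]: "\<phi> \<in> borel_measurable A" "\<psi> \<in> borel_measurable B"
    and "integrable M (\<lambda>\<omega>. (\<phi> (U \<omega>))\<^sup>2)" "integrable M (\<lambda>\<omega>. (\<psi> (V \<omega>))\<^sup>2)"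
    and v: "0 < variance (\<lambda>\<omega>. \<phi> (U \<omega>))" "0 < variance (\<lambda>\<omega>. \<psi> (V \<omega>))"
  then have "sqint M (\<lambda>\<omega>. \<phi> (U \<omega>))" "sqint M (\<lambda>\<omega>. \<psi> (V \<omega>))"
    by (simp_all add: sqint_def)
  with * v show "\<exists>\<phi> \<psi>. x = cov M (\<lambda>\<omega>. \<phi> (U \<omega>)) (\<lambda>\<omega>. \<psi> (V \<omega>)) /
      (sqrt (cov M (\<lambda>\<omega>. \<phi> (U \<omega>)) (\<lambda>\<omega>. \<phi> (U \<omega>))) * sqrt (cov M (\<lambda>\<omega>. \<psi> (V \<omega>)) (\<lambda>\<omega>. \<psi> (V \<omega>)))) \<and>
      \<phi> \<in> borel_measurable A \<and> \<psi> \<in> borel_measurable B \<and>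
      sqint M (\<lambda>\<omega>. \<phi> (U \<omega>)) \<and> sqint M (\<lambda>\<omega>. \<psi> (V \<omega>)) \<and>
      0 < cov M (\<lambda>\<omega>. \<phi> (U \<omega>)) (\<lambda>\<omega>. \<phi> (U \<omega>)) \<and> 0 < cov M (\<lambda>\<omega>. \<psi> (V \<omega>)) (\<lambda>\<omega>. \<psi> (V \<omega>))"
    by (intro exI[of _ \<phi>] exI[of _ \<psi>]) (simp add: pearson_corr_eq_cov variance_eq_cov)
next
  fix x \<phi> \<psi>
  assume "x = cov M (\<lambda>\<omega>. \<phi> (U \<omega>)) (\<lambda>\<omega>. \<psi> (V \<omega>)) /
      (sqrt (cov M (\<lambda>\<omega>. \<phi> (U \<omega>)) (\<lambda>\<omega>. \<phi> (U \<omega>))) * sqrt (cov M (\<lambda>\<omega>. \<psi> (V \<omega>)) (\<lambda>\<omega>. \<psi> (V \<omega>))))"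
    and "\<phi> \<in> borel_measurable A" "\<psi> \<in> borel_measurable B"
    and "sqint M (\<lambda>\<omega>. \<phi> (U \<omega>))" "sqint M (\<lambda>\<omega>. \<psi> (V \<omega>))"
    and "0 < cov M (\<lambda>\<omega>. \<phi> (U \<omega>)) (\<lambda>\<omega>. \<phi> (U \<omega>))" "0 < cov M (\<lambda>\<omega>. \<psi> (V \<omega>)) (\<lambda>\<omega>. \<psi> (V \<omega>))"
  then show "\<exists>\<phi> \<psi>. x = pearson_corr M (\<lambda>\<omega>. \<phi> (U \<omega>)) (\<lambda>\<omega>. \<psi> (V \<omega>)) \<and>
      \<phi> \<in> borel_measurable A \<and> \<psi> \<in> borel_measurable B \<and>
      integrable M (\<lambda>\<omega>. (\<phi> (U \<omega>))\<^sup>2) \<and> integrable M (\<lambda>\<omega>. (\<psi> (V \<omega>))\<^sup>2) \<and>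
      0 < variance (\<lambda>\<omega>. \<phi> (U \<omega>)) \<and> 0 < variance (\<lambda>\<omega>. \<psi> (V \<omega>))"
    by (intro exI[of _ \<phi>] exI[of _ \<psi>])
       (simp add: pearson_corr_eq_cov variance_eq_cov, simp add: sqint_def)
qed

text \<open>Together with \<open>cov_le_max_corr\<close> and \<open>max_corr_nonneg\<close> this
  makes \<open>max_corr\<close> the least nonnegative constant in a covariance inequality, so the
  supremum and its quotients do not occur again. In the degenerate case the value is 0 by convention
  and \<open>0 \<le> c\<close> decides; otherwise \<open>nondegenerateD\<close> supplies the test
  functions that make the set of correlations nonempty.\<close>

lemma max_corr_least:
  assumes c: "0 \<le> c"
    and le: "\<And>\<phi> \<psi>. \<lbrakk>\<phi> \<in> borel_measurable A; \<psi> \<in> borel_measurable B;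
        sqint M (\<lambda>\<omega>. \<phi> (U \<omega>)); sqint M (\<lambda>\<omega>. \<psi> (V \<omega>))\<rbrakk> \<Longrightarrow>
      cov M (\<lambda>\<omega>. \<phi> (U \<omega>)) (\<lambda>\<omega>. \<psi> (V \<omega>)) \<le>
        c * sqrt (cov M (\<lambda>\<omega>. \<phi> (U \<omega>)) (\<lambda>\<omega>. \<phi> (U \<omega>))) * sqrt (cov M (\<lambda>\<omega>. \<psi> (V \<omega>)) (\<lambda>\<omega>. \<psi> (V \<omega>)))"
  shows "max_corr M A U B V \<le> c"
proof (cases "degenerate M A U \<or> degenerate M B V")
  case True
  then show ?thesis
    using c by (simp add: max_corr_def)
next
  case False
  obtain \<phi> where \<phi>: "\<phi> \<in> borel_measurable A" "sqint M (\<lambda>\<omega>. \<phi> (U \<omega>))"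
    "0 < cov M (\<lambda>\<omega>. \<phi> (U \<omega>)) (\<lambda>\<omega>. \<phi> (U \<omega>))"
    using False by (auto elim: nondegenerateD[OF U])
  obtain \<psi> where \<psi>: "\<psi> \<in> borel_measurable B" "sqint M (\<lambda>\<omega>. \<psi> (V \<omega>))"
    "0 < cov M (\<lambda>\<omega>. \<psi> (V \<omega>)) (\<lambda>\<omega>. \<psi> (V \<omega>))"
    using False by (auto elim: nondegenerateD[OF V])
  have "max_corr M A U B V = Sup {cov M (\<lambda>\<omega>. \<phi> (U \<omega>)) (\<lambda>\<omega>. \<psi> (V \<omega>)) /
      (sqrt (cov M (\<lambda>\<omega>. \<phi> (U \<omega>)) (\<lambda>\<omega>. \<phi> (U \<omega>))) * sqrt (cov M (\<lambda>\<omega>. \<psi> (V \<omega>)) (\<lambda>\<omega>. \<psi> (V \<omega>)))) | \<phi> \<psi>.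
      \<phi> \<in> borel_measurable A \<and> \<psi> \<in> borel_measurable B \<and>
      sqint M (\<lambda>\<omega>. \<phi> (U \<omega>)) \<and> sqint M (\<lambda>\<omega>. \<psi> (V \<omega>)) \<and>
      0 < cov M (\<lambda>\<omega>. \<phi> (U \<omega>)) (\<lambda>\<omega>. \<phi> (U \<omega>)) \<and>
      0 < cov M (\<lambda>\<omega>. \<psi> (V \<omega>)) (\<lambda>\<omega>. \<psi> (V \<omega>))}" (is "_ = Sup ?R")
    unfolding max_corr_def max_corr_set_eq using False by simp
  also have "\<dots> \<le> c"
  proof (rule cSup_least)
    show "?R \<noteq> {}"
      using \<phi> \<psi> by blast
  next
    fix x assume "x \<in> ?R"
    then show "x \<le> c"
      using le by (auto simp: divide_le_eq mult.assoc)
  qed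
  finally show ?thesis .
qed

text \<open>If a variance is 0, so is the covariance, by Cauchy-Schwarz. If both are positive, they
  witness that neither element is degenerate, so \<open>max_corr\<close> is a true supremum, of a
  set that Cauchy-Schwarz bounds by 1.\<close>

lemma cov_le_max_corr:
  assumes \<phi>: "\<phi> \<in> borel_measurable A" "sqint M (\<lambda>\<omega>. \<phi> (U \<omega>))"
    and \<psi>: "\<psi> \<in> borel_measurable B" "sqint M (\<lambda>\<omega>. \<psi> (V \<omega>))"
  shows "cov M (\<lambda>\<omega>. \<phi> (U \<omega>)) (\<lambda>\<omega>. \<psi> (V \<omega>)) \<le> max_corr M A U B V *
     sqrt (cov M (\<lambda>\<omega>. \<phi> (U \<omega>)) (\<lambda>\<omega>. \<phi> (U \<omega>))) * sqrt (cov M (\<lambda>\<omega>. \<psi> (V \<omega>)) (\<lambda>\<omega>. \<psi> (V \<omega>)))"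
proof (cases "cov M (\<lambda>\<omega>. \<phi> (U \<omega>)) (\<lambda>\<omega>. \<phi> (U \<omega>)) = 0 \<or> cov M (\<lambda>\<omega>. \<psi> (V \<omega>)) (\<lambda>\<omega>. \<psi> (V \<omega>)) = 0")
  case True
  then show ?thesis
    using cov_le_sqrt[OF \<phi>(2) \<psi>(2)] by auto
next
  case False
  then have pos: "0 < cov M (\<lambda>\<omega>. \<phi> (U \<omega>)) (\<lambda>\<omega>. \<phi> (U \<omega>))" "0 < cov M (\<lambda>\<omega>. \<psi> (V \<omega>)) (\<lambda>\<omega>. \<psi> (V \<omega>))"
    using cov_nonneg[OF \<phi>(2)] cov_nonneg[OF \<psi>(2)] by linarith+
  have nd: "\<not> degenerate M A U" "\<not> degenerate M B V"
    using cov_pos_imp_nondegenerate[OF \<phi> pos(1)] cov_pos_imp_nondegenerate[OF \<psi> pos(2)] by simp_all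
  have eq: "max_corr M A U B V = Sup {cov M (\<lambda>\<omega>. \<phi> (U \<omega>)) (\<lambda>\<omega>. \<psi> (V \<omega>)) /
      (sqrt (cov M (\<lambda>\<omega>. \<phi> (U \<omega>)) (\<lambda>\<omega>. \<phi> (U \<omega>))) * sqrt (cov M (\<lambda>\<omega>. \<psi> (V \<omega>)) (\<lambda>\<omega>. \<psi> (V \<omega>)))) | \<phi> \<psi>.
      \<phi> \<in> borel_measurable A \<and> \<psi> \<in> borel_measurable B \<and>
      sqint M (\<lambda>\<omega>. \<phi> (U \<omega>)) \<and> sqint M (\<lambda>\<omega>. \<psi> (V \<omega>)) \<and>
      0 < cov M (\<lambda>\<omega>. \<phi> (U \<omega>)) (\<lambda>\<omega>. \<phi> (U \<omega>)) \<and>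
      0 < cov M (\<lambda>\<omega>. \<psi> (V \<omega>)) (\<lambda>\<omega>. \<psi> (V \<omega>))}" (is "_ = Sup ?R")
    unfolding max_corr_def max_corr_set_eq using nd by simp
  have "cov M (\<lambda>\<omega>. \<phi> (U \<omega>)) (\<lambda>\<omega>. \<psi> (V \<omega>)) /
     (sqrt (cov M (\<lambda>\<omega>. \<phi> (U \<omega>)) (\<lambda>\<omega>. \<phi> (U \<omega>))) * sqrt (cov M (\<lambda>\<omega>. \<psi> (V \<omega>)) (\<lambda>\<omega>. \<psi> (V \<omega>)))) \<le> Sup ?R"
  proof (rule cSup_upper)
    show "bdd_above ?R"
      using cov_le_sqrt by (intro bdd_aboveI[of _ 1]) (fastforce simp: divide_le_eq abs_le_iff)
  qed (use \<phi> \<psi> pos in blast)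
  then show ?thesis
    unfolding eq[symmetric] using pos by (simp add: divide_le_eq mult.assoc)
qed

text \<open>Negating \<open>\<phi>\<close> negates the covariance and keeps both variances, so
  correlations occur in pairs of opposite sign.\<close>

lemma max_corr_nonneg: "0 \<le> max_corr M A U B V"
proof (cases "degenerate M A U \<or> degenerate M B V")
  case True
  then show ?thesis
    by (simp add: max_corr_def)
next
  case False
  obtain \<phi> where \<phi>: "\<phi> \<in> borel_measurable A" "sqint M (\<lambda>\<omega>. \<phi> (U \<omega>))"
    "0 < cov M (\<lambda>\<omega>. \<phi> (U \<omega>)) (\<lambda>\<omega>. \<phi> (U \<omega>))"
    using False by (auto elim: nondegenerateD[OF U])
  obtain \<psi> where \<psi>: "\<psi> \<in> borel_measurable B" "sqint M (\<lambda>\<omega>. \<psi> (V \<omega>))"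
    "0 < cov M (\<lambda>\<omega>. \<psi> (V \<omega>)) (\<lambda>\<omega>. \<psi> (V \<omega>))"
    using False by (auto elim: nondegenerateD[OF V])
  define d where "d = sqrt (cov M (\<lambda>\<omega>. \<phi> (U \<omega>)) (\<lambda>\<omega>. \<phi> (U \<omega>))) * sqrt (cov M (\<lambda>\<omega>. \<psi> (V \<omega>)) (\<lambda>\<omega>. \<psi> (V \<omega>)))"
  have "0 < d"
    using \<phi>(3) \<psi>(3) by (simp add: d_def)
  have "(\<lambda>a. - \<phi> a) \<in> borel_measurable A" "sqint M (\<lambda>\<omega>. - \<phi> (U \<omega>))"
    using \<phi> by (simp_all add: sqint_def)
  from cov_le_max_corr[OF this \<psi>(1,2)]
  have "- cov M (\<lambda>\<omega>. \<phi> (U \<omega>)) (\<lambda>\<omega>. \<psi> (V \<omega>)) \<le> max_corr M A U B V * d"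
    by (simp add: cov_def d_def mult.assoc)
  moreover have "cov M (\<lambda>\<omega>. \<phi> (U \<omega>)) (\<lambda>\<omega>. \<psi> (V \<omega>)) \<le> max_corr M A U B V * d"
    using cov_le_max_corr[OF \<phi>(1,2) \<psi>(1,2)] by (simp add: d_def mult.assoc)
  ultimately have "0 \<le> max_corr M A U B V * d"
    by linarith
  with \<open>0 < d\<close> show ?thesis
    by (simp add: zero_le_mult_iff)
qed

end

end

section \<open>Covariances on product spaces\<close>

lemma sqint_distr_iff:
  assumes [measurable]: "g \<in> measurable M N" "f \<in> borel_measurable N"
  shows "sqint (distr M N g) f \<longleftrightarrow> sqint M (\<lambda>x. f (g x))"
  by (simp add: sqint_def integrable_distr_eq)

lemma cov_distr:
  assumes [measurable]: "g \<in> measurable M N" "u \<in> borel_measurable N" "v \<in> borel_measurable N"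
  shows "cov (distr M N g) u v = cov M (\<lambda>x. u (g x)) (\<lambda>x. v (g x))"
  by (simp add: cov_def integral_distr)

locale pair_prob = A?: prob_space A + B?: prob_space B for A :: "'a measure" and B :: "'b measure"
begin

sublocale pair_prob_space A B ..

text \<open>The conditional expectation of \<open>u\<close> given the first coordinate.\<close>

definition marg :: "('a \<times> 'b \<Rightarrow> real) \<Rightarrow> 'a \<Rightarrow> real" where
  "marg u x = (\<integral>y. u (x, y) \<partial>B)"

lemma marg_measurable[measurable]:
  assumes [measurable]: "u \<in> borel_measurable (A \<Otimes>\<^sub>M B)"
  shows "marg u \<in> borel_measurable A"
  unfolding marg_def by measurable

text \<open>Conditional Jensen: the square of the average over \<open>y\<close> is at most the
  average of the square. It is applied only for almost every \<open>x\<close>, since only almost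
  every section is known to be square integrable.\<close>

lemma sqint_marg:
  assumes u: "sqint (A \<Otimes>\<^sub>M B) u"
  shows "sqint A (marg u)"
proof -
  have [measurable]: "u \<in> borel_measurable (A \<Otimes>\<^sub>M B)"
    and i: "integrable (A \<Otimes>\<^sub>M B) (\<lambda>z. (u z)\<^sup>2)"
    using u by (simp_all add: sqint_def)
  have "integrable A (\<lambda>x. (marg u x)\<^sup>2)"
  proof (rule Bochner_Integration.integrable_bound)
    show "integrable A (\<lambda>x. \<integral>y. (u (x, y))\<^sup>2 \<partial>B)"
      by (rule integrable_fst'[OF i])
    show "AE x in A. norm ((marg u x)\<^sup>2) \<le> norm (\<integral>y. (u (x, y))\<^sup>2 \<partial>B)"
      using AE_integrable_fst'[OF i] AE_space
    proof eventually_elim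
      case (elim x)
      then have "sqint B (\<lambda>y. u (x, y))"
        by (simp add: sqint_def)
      from B.expectation_square_le[OF this] show ?case
        by (simp add: marg_def)
    qed
  qed simp
  then show ?thesis
    by (simp add: sqint_def)
qed

lemma sqint_fst:
  assumes f: "sqint A f"
  shows "sqint (A \<Otimes>\<^sub>M B) (\<lambda>z. f (fst z))"
proof -
  have [measurable]: "f \<in> borel_measurable A" and i: "integrable A (\<lambda>x. (f x)\<^sup>2)"
    using f by (simp_all add: sqint_def)
  have "integrable (A \<Otimes>\<^sub>M B) (\<lambda>z. (f (fst z))\<^sup>2)"
    by (rule Fubini_integrable) (use i in \<open>simp_all add: B.prob_space\<close>)
  then show ?thesis
    by (simp add: sqint_def)
qed

lemma integral_fst_mult:
  assumes f: "sqint A f" and v: "sqint (A \<Otimes>\<^sub>M B) v"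
  shows "(\<integral>z. f (fst z) * v z \<partial>(A \<Otimes>\<^sub>M B)) = (\<integral>x. f x * marg v x \<partial>A)"
  using integral_fst'[OF sqint_mult_integrable[OF sqint_fst[OF f] v]] by (simp add: marg_def)

lemma integral_marg:
  assumes v: "sqint (A \<Otimes>\<^sub>M B) v"
  shows "(\<integral>z. v z \<partial>(A \<Otimes>\<^sub>M B)) = (\<integral>x. marg v x \<partial>A)"
  using integral_fst_mult[OF A.sqint_const[of 1] v] by simp

lemma marg_fst: "marg (\<lambda>z. f (fst z)) = f"
  by (simp add: marg_def B.prob_space fun_eq_iff)

lemma sqint_minus_marg:
  "sqint (A \<Otimes>\<^sub>M B) u \<Longrightarrow> sqint (A \<Otimes>\<^sub>M B) (\<lambda>z. u z - marg u (fst z))"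
  by (intro sqint_diff sqint_fst sqint_marg)

text \<open>In the expanded product of the residuals, each of the three terms that contain a
  marginal integrates to the same number, the integral of \<open>marg u * marg v\<close>, with signs
  minus, minus and plus. One negative copy survives.\<close>

lemma total_covariance:
  assumes u: "sqint (A \<Otimes>\<^sub>M B) u" and v: "sqint (A \<Otimes>\<^sub>M B) v"
  shows "cov (A \<Otimes>\<^sub>M B) u v =
    (\<integral>z. (u z - marg u (fst z)) * (v z - marg v (fst z)) \<partial>(A \<Otimes>\<^sub>M B)) + cov A (marg u) (marg v)"
proof -
  note u' = sqint_marg[OF u] and v' = sqint_marg[OF v]
  note u'' = sqint_fst[OF u'] and v'' = sqint_fst[OF v']
  have "(\<integral>z. (u z - marg u (fst z)) * (v z - marg v (fst z)) \<partial>(A \<Otimes>\<^sub>M B)) =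
     (\<integral>z. u z * v z - marg u (fst z) * v z - marg v (fst z) * u z +
        marg u (fst z) * marg v (fst z) \<partial>(A \<Otimes>\<^sub>M B))"
    by (intro Bochner_Integration.integral_cong) (auto simp: algebra_simps)
  also have "\<dots> = (\<integral>z. u z * v z \<partial>(A \<Otimes>\<^sub>M B)) - (\<integral>x. marg u x * marg v x \<partial>A)
     - (\<integral>x. marg v x * marg u x \<partial>A) + (\<integral>x. marg u x * marg v x \<partial>A)"
    using sqint_mult_integrable[OF u v] sqint_mult_integrable[OF u'' v]
      sqint_mult_integrable[OF v'' u] sqint_mult_integrable[OF u'' v'']
      integral_fst_mult[OF u' v] integral_fst_mult[OF v' u] integral_fst_mult[OF u' v'']
    by (simp add: marg_fst)
  also have "\<dots> = (\<integral>z. u z * v z \<partial>(A \<Otimes>\<^sub>M B)) - (\<integral>x. marg u x * marg v x \<partial>A)"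
    by (simp add: mult.commute)
  finally show ?thesis
    by (simp add: cov_def integral_marg[OF u] integral_marg[OF v])
qed

text \<open>The induction step for product spaces. \<open>P i\<close> marks the functions
  \<open>u i\<close> that may depend on the second coordinate; for the others the residual after
  averaging is 0. Hypothesis \<open>le\<close> controls the residuals and \<open>marg_le\<close> the
  averages. Since both have the same constant \<open>r\<close>, their sum has again the form of the
  conclusion.\<close>

lemma weighted_cov_pair_le:
  fixes u :: "'i \<Rightarrow> 'a \<times> 'b \<Rightarrow> real" and v :: "'j \<Rightarrow> 'a \<times> 'b \<Rightarrow> real"
  assumes r: "0 \<le> r" and q: "\<And>i. i \<in> I \<Longrightarrow> 0 \<le> q i" and q': "\<And>j. j \<in> J \<Longrightarrow> 0 \<le> q' j"
    and u: "\<And>i. i \<in> I \<Longrightarrow> sqint (A \<Otimes>\<^sub>M B) (u i)"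
    and v: "\<And>j. j \<in> J \<Longrightarrow> sqint (A \<Otimes>\<^sub>M B) (v j)"
    and u_fst: "\<And>i x y y'. \<lbrakk>i \<in> I; \<not> P i; x \<in> space A; y \<in> space B; y' \<in> space B\<rbrakk> \<Longrightarrow> u i (x, y) = u i (x, y')"
    and v_fst: "\<And>j x y y'. \<lbrakk>j \<in> J; \<not> P' j; x \<in> space A; y \<in> space B; y' \<in> space B\<rbrakk> \<Longrightarrow> v j (x, y) = v j (x, y')"
    and le: "\<And>\<alpha> \<beta>. \<lbrakk>\<And>i. i \<in> I \<Longrightarrow> \<not> P i \<Longrightarrow> \<alpha> i = 0; \<And>j. j \<in> J \<Longrightarrow> \<not> P' j \<Longrightarrow> \<beta> j = 0\<rbrakk> \<Longrightarrow>
      (\<Sum>i\<in>I. \<Sum>j\<in>J. p i j * (\<alpha> i * \<beta> j)) \<le>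
        r * (sqrt (\<Sum>i\<in>I. q i * (\<alpha> i)\<^sup>2) * sqrt (\<Sum>j\<in>J. q' j * (\<beta> j)\<^sup>2))"
    and marg_le: "(\<Sum>i\<in>I. \<Sum>j\<in>J. p i j * cov A (marg (u i)) (marg (v j))) \<le>
      r * (sqrt (\<Sum>i\<in>I. q i * cov A (marg (u i)) (marg (u i))) *
           sqrt (\<Sum>j\<in>J. q' j * cov A (marg (v j)) (marg (v j))))"
  shows "(\<Sum>i\<in>I. \<Sum>j\<in>J. p i j * cov (A \<Otimes>\<^sub>M B) (u i) (v j)) \<le>
      r * (sqrt (\<Sum>i\<in>I. q i * cov (A \<Otimes>\<^sub>M B) (u i) (u i)) *
           sqrt (\<Sum>j\<in>J. q' j * cov (A \<Otimes>\<^sub>M B) (v j) (v j)))"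
proof -
  let ?P = "A \<Otimes>\<^sub>M B"
  define D where "D i z = u i z - marg (u i) (fst z)" for i z
  define E where "E j z = v j z - marg (v j) (fst z)" for j z
  define G where "G z = (\<Sum>i\<in>I. q i * (D i z)\<^sup>2)" for z
  define H where "H z = (\<Sum>j\<in>J. q' j * (E j z)\<^sup>2)" for z
  have D: "sqint ?P (D i)" if "i \<in> I" for i
    using sqint_minus_marg[OF u[OF that]] by (simp add: D_def[abs_def])
  have E: "sqint ?P (E j)" if "j \<in> J" for j
    using sqint_minus_marg[OF v[OF that]] by (simp add: E_def[abs_def])
  have D0: "D i z = 0" if "i \<in> I" "\<not> P i" "z \<in> space ?P" for i z
  proof -
    obtain x y where z: "z = (x, y)" "x \<in> space A" "y \<in> space B"
      using \<open>z \<in> space ?P\<close> by (auto simp: space_pair_measure)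
    \<comment> \<open>The section does not depend on \<open>y\<close>, so its average is its value
      and the residual vanishes.\<close>
    have "marg (u i) x = (\<integral>y'. u i (x, y) \<partial>B)"
      unfolding marg_def using u_fst[OF that(1,2) z(2) _ z(3)]
      by (intro Bochner_Integration.integral_cong) auto
    then show ?thesis
      by (simp add: D_def z B.prob_space)
  qed
  have E0: "E j z = 0" if "j \<in> J" "\<not> P' j" "z \<in> space ?P" for j z
  proof -
    obtain x y where z: "z = (x, y)" "x \<in> space A" "y \<in> space B"
      using \<open>z \<in> space ?P\<close> by (auto simp: space_pair_measure)
    have "marg (v j) x = (\<integral>y'. v j (x, y) \<partial>B)"
      unfolding marg_def using v_fst[OF that(1,2) z(2) _ z(3)]
      by (intro Bochner_Integration.integral_cong) auto
    then show ?thesis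
      by (simp add: E_def z B.prob_space)
  qed
  have G: "integrable ?P G" "\<And>z. 0 \<le> G z"
    using D q by (auto simp: G_def[abs_def] sqint_def intro!: sum_nonneg)
  have H: "integrable ?P H" "\<And>z. 0 \<le> H z"
    using E q' by (auto simp: H_def[abs_def] sqint_def intro!: sum_nonneg)
  have [simp]: "integrable ?P (\<lambda>z. D i z * E j z)" if "i \<in> I" "j \<in> J" for i j
    using sqint_mult_integrable[OF D[OF that(1)] E[OF that(2)]] .
  have "(\<Sum>i\<in>I. \<Sum>j\<in>J. p i j * (\<integral>z. D i z * E j z \<partial>?P)) =
      (\<integral>z. (\<Sum>i\<in>I. \<Sum>j\<in>J. p i j * (D i z * E j z)) \<partial>?P)"
    by simp
  \<comment> \<open>For fixed \<open>z\<close> the numbers \<open>D i z\<close> and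
    \<open>E j z\<close> are taken as the coefficients \<open>\<alpha> i\<close> and
    \<open>\<beta> j\<close> in \<open>le\<close>; \<open>D0\<close> and \<open>E0\<close> are the
    vanishing conditions it asks for.\<close>
  also have "\<dots> \<le> (\<integral>z. r * (sqrt (G z) * sqrt (H z)) \<partial>?P)"
  proof (rule integral_mono)
    show "integrable ?P (\<lambda>z. r * (sqrt (G z) * sqrt (H z)))"
      using integral_sqrt_mult_le(1)[OF G(1) H(1) G(2) H(2)] by simp
    fix z assume "z \<in> space ?P"
    then show "(\<Sum>i\<in>I. \<Sum>j\<in>J. p i j * (D i z * E j z)) \<le> r * (sqrt (G z) * sqrt (H z))"
      unfolding G_def H_def by (intro le D0 E0)
  qed simp
  also have "\<dots> \<le> r * (sqrt (\<integral>z. G z \<partial>?P) * sqrt (\<integral>z. H z \<partial>?P))"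
    using integral_sqrt_mult_le(2)[OF G(1) H(1) G(2) H(2)] r by (simp add: mult_left_mono)
  finally have *: "(\<Sum>i\<in>I. \<Sum>j\<in>J. p i j * (\<integral>z. D i z * E j z \<partial>?P)) \<le>
      r * (sqrt (\<integral>z. G z \<partial>?P) * sqrt (\<integral>z. H z \<partial>?P))" .
  define G' where "G' = (\<Sum>i\<in>I. q i * cov A (marg (u i)) (marg (u i)))"
  define H' where "H' = (\<Sum>j\<in>J. q' j * cov A (marg (v j)) (marg (v j)))"
  have G'0: "0 \<le> G'" "0 \<le> H'"
    unfolding G'_def H'_def
    by (auto intro!: sum_nonneg mult_nonneg_nonneg q q' A.cov_nonneg sqint_marg u v)
  have GG: "(\<Sum>i\<in>I. q i * cov ?P (u i) (u i)) = (\<integral>z. G z \<partial>?P) + G'"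
    using D by (simp add: G_def G'_def sqint_def sum.distrib[symmetric] distrib_left[symmetric]
      total_covariance[OF u u] D_def[symmetric] power2_eq_square)
  have HH: "(\<Sum>j\<in>J. q' j * cov ?P (v j) (v j)) = (\<integral>z. H z \<partial>?P) + H'"
    using E by (simp add: H_def H'_def sqint_def sum.distrib[symmetric] distrib_left[symmetric]
      total_covariance[OF v v] E_def[symmetric] power2_eq_square)
  have "(\<Sum>i\<in>I. \<Sum>j\<in>J. p i j * cov ?P (u i) (v j)) =
      (\<Sum>i\<in>I. \<Sum>j\<in>J. p i j * (\<integral>z. D i z * E j z \<partial>?P)) +
      (\<Sum>i\<in>I. \<Sum>j\<in>J. p i j * cov A (marg (u i)) (marg (v j)))"
    by (simp add: sum.distrib[symmetric] distrib_left[symmetric] total_covariance[OF u v]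
      D_def[symmetric] E_def[symmetric])
  also have "\<dots> \<le> r * (sqrt (\<integral>z. G z \<partial>?P) * sqrt (\<integral>z. H z \<partial>?P) + sqrt G' * sqrt H')"
    using * marg_le by (simp add: G'_def H'_def distrib_left)
  also have "\<dots> \<le> r * (sqrt ((\<integral>z. G z \<partial>?P) + G') * sqrt ((\<integral>z. H z \<partial>?P) + H'))"
    using G H G'0 r by (intro mult_left_mono sqrt_mult_add_le) auto
  finally show ?thesis
    by (simp add: GG HH)
qed

end

text \<open>Tensorization: an inequality for coefficient vectors that holds with the constant
  \<open>r\<close> at each coordinate passes to covariances on the whole product with the same
  \<open>r\<close>. \<open>P k i\<close> says that \<open>u i\<close> may depend on the coordinate
  \<open>k\<close>. The families \<open>u\<close> and \<open>v\<close> are generalized in the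
  induction because its hypothesis is applied to their marginals.\<close>

lemma weighted_cov_PiM_le:
  fixes \<mu> :: "'k \<Rightarrow> 'a measure" and u :: "'i \<Rightarrow> ('k \<Rightarrow> 'a) \<Rightarrow> real" and v :: "'j \<Rightarrow> ('k \<Rightarrow> 'a) \<Rightarrow> real"
  assumes "finite K" and \<mu>: "\<And>k. k \<in> K \<Longrightarrow> prob_space (\<mu> k)"
    and r: "0 \<le> r" and q: "\<And>i. i \<in> I \<Longrightarrow> 0 \<le> q i" and q': "\<And>j. j \<in> J \<Longrightarrow> 0 \<le> q' j"
    and u: "\<And>i. i \<in> I \<Longrightarrow> sqint (PiM K \<mu>) (u i)"
    and v: "\<And>j. j \<in> J \<Longrightarrow> sqint (PiM K \<mu>) (v j)"
    and u_indep: "\<And>k i x y. \<lbrakk>k \<in> K; i \<in> I; \<not> P k i; x \<in> space (PiM K \<mu>); y \<in> space (\<mu> k)\<rbrakk> \<Longrightarrow> u i (x(k := y)) = u i x"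
    and v_indep: "\<And>k j x y. \<lbrakk>k \<in> K; j \<in> J; \<not> P' k j; x \<in> space (PiM K \<mu>); y \<in> space (\<mu> k)\<rbrakk> \<Longrightarrow> v j (x(k := y)) = v j x"
    and le: "\<And>k \<alpha> \<beta>. \<lbrakk>k \<in> K; \<And>i. i \<in> I \<Longrightarrow> \<not> P k i \<Longrightarrow> \<alpha> i = 0; \<And>j. j \<in> J \<Longrightarrow> \<not> P' k j \<Longrightarrow> \<beta> j = 0\<rbrakk> \<Longrightarrow>
      (\<Sum>i\<in>I. \<Sum>j\<in>J. p i j * (\<alpha> i * \<beta> j)) \<le>
        r * (sqrt (\<Sum>i\<in>I. q i * (\<alpha> i)\<^sup>2) * sqrt (\<Sum>j\<in>J. q' j * (\<beta> j)\<^sup>2))"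
  shows "(\<Sum>i\<in>I. \<Sum>j\<in>J. p i j * cov (PiM K \<mu>) (u i) (v j)) \<le>
      r * (sqrt (\<Sum>i\<in>I. q i * cov (PiM K \<mu>) (u i) (u i)) *
           sqrt (\<Sum>j\<in>J. q' j * cov (PiM K \<mu>) (v j) (v j)))"
  using assms(1) \<mu> u v u_indep v_indep le
proof (induction K arbitrary: u v rule: finite_induct)
  case empty
  interpret E: prob_space "PiM {} \<mu>"
    by (rule prob_space_PiM) simp
  \<comment> \<open>The empty product has a single point, so every function on it is
    constant.\<close>
  have *: "cov (PiM {} \<mu>) f g = 0" for f g :: "('k \<Rightarrow> 'a) \<Rightarrow> real"
  proof -
    have "(\<integral>x. h x \<partial>PiM {} \<mu>) = h (\<lambda>_. undefined)" for h :: "('k \<Rightarrow> 'a) \<Rightarrow> real"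
    proof -
      have "(\<integral>x. h x \<partial>PiM {} \<mu>) = (\<integral>x. h (\<lambda>_. undefined) \<partial>PiM {} \<mu>)"
        by (intro Bochner_Integration.integral_cong) (auto simp: space_PiM_empty)
      then show ?thesis
        by (simp add: E.prob_space)
    qed
    then show ?thesis
      by (simp add: cov_def)
  qed
  show ?case
    by (simp add: *)
next
  case (insert k K)
  let ?A = "PiM K \<mu>" and ?B = "\<mu> k" and ?C = "PiM (insert k K) \<mu>"
  define T where "T = (\<lambda>(x :: 'k \<Rightarrow> 'a, y). x(k := y))"
  interpret A: prob_space ?A
    by (rule prob_space_PiM) (simp add: insert.prems(1))
  interpret B: prob_space ?B
    by (simp add: insert.prems(1))
  interpret pair_prob ?A ?B ..
  have T[measurable]: "T \<in> measurable (?A \<Otimes>\<^sub>M ?B) ?C"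
    unfolding T_def by measurable
  \<comment> \<open>The gluing map is first obtained with the new coordinate in front. The swap
    moves it to the second place, which is the one that \<open>marg\<close> integrates out.\<close>
  have "?C = distr (?B \<Otimes>\<^sub>M ?A) ?C (\<lambda>(y, x). x(k := y))"
    using insert.prems(1) by (intro distr_pair_PiM_eq_PiM[symmetric]) auto
  also have "?B \<Otimes>\<^sub>M ?A = distr (?A \<Otimes>\<^sub>M ?B) (?B \<Otimes>\<^sub>M ?A) (\<lambda>(x, y). (y, x))"
  proof -
    interpret Q: pair_prob ?B ?A ..
    show ?thesis by (rule Q.distr_pair_swap)
  qed
  also have "distr \<dots> ?C (\<lambda>(y, x). x(k := y)) = distr (?A \<Otimes>\<^sub>M ?B) ?C T"
    by (subst distr_distr) (auto simp: T_def o_def case_prod_beta intro!: distr_cong)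
  finally have C: "?C = distr (?A \<Otimes>\<^sub>M ?B) ?C T" .
  have spT: "x(k := y) \<in> space ?C" if "x \<in> space ?A" "y \<in> space ?B" for x y
    using measurable_space[OF T, of "(x, y)"] that by (simp add: T_def space_pair_measure)
  have um[measurable]: "i \<in> I \<Longrightarrow> u i \<in> borel_measurable ?C" for i
    using insert.prems(2) by (simp add: sqint_def)
  have vm[measurable]: "j \<in> J \<Longrightarrow> v j \<in> borel_measurable ?C" for j
    using insert.prems(3) by (simp add: sqint_def)
  have u': "sqint (?A \<Otimes>\<^sub>M ?B) (\<lambda>z. u i (T z))" if "i \<in> I" for i
    using insert.prems(2)[OF that] C sqint_distr_iff[OF T um[OF that]] by simp
  have v': "sqint (?A \<Otimes>\<^sub>M ?B) (\<lambda>z. v j (T z))" if "j \<in> J" for j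
    using insert.prems(3)[OF that] C sqint_distr_iff[OF T vm[OF that]] by simp
  have cov_C: "cov ?C f g = cov (?A \<Otimes>\<^sub>M ?B) (\<lambda>z. f (T z)) (\<lambda>z. g (T z))"
    if "f \<in> borel_measurable ?C" "g \<in> borel_measurable ?C" for f g
    using C cov_distr[OF T that] by simp
  \<comment> \<open>Averaging over the coordinate \<open>k\<close> creates no dependence on another
    coordinate \<open>l\<close>, since updates at distinct places commute.\<close>
  have u_marg: "marg (\<lambda>z. u i (T z)) (x(l := y)) = marg (\<lambda>z. u i (T z)) x"
    if "l \<in> K" "i \<in> I" "\<not> P l i" "x \<in> space ?A" "y \<in> space (\<mu> l)" for l i x y
    unfolding marg_def
  proof (intro Bochner_Integration.integral_cong refl)
    fix y' assume y': "y' \<in> space ?B"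
    have "l \<noteq> k"
      using that insert.hyps by auto
    then show "u i (T (x(l := y), y')) = u i (T (x, y'))"
      using insert.prems(4)[OF _ that(2,3) spT[OF that(4) y'] that(5)] that(1)
      unfolding T_def prod.case by (metis fun_upd_twist insertI2)
  qed
  have v_marg: "marg (\<lambda>z. v j (T z)) (x(l := y)) = marg (\<lambda>z. v j (T z)) x"
    if "l \<in> K" "j \<in> J" "\<not> P' l j" "x \<in> space ?A" "y \<in> space (\<mu> l)" for l j x y
    unfolding marg_def
  proof (intro Bochner_Integration.integral_cong refl)
    fix y' assume y': "y' \<in> space ?B"
    have "l \<noteq> k"
      using that insert.hyps by auto
    then show "v j (T (x(l := y), y')) = v j (T (x, y'))"
      using insert.prems(5)[OF _ that(2,3) spT[OF that(4) y'] that(5)] that(1)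
      unfolding T_def prod.case by (metis fun_upd_twist insertI2)
  qed
  have "(\<Sum>i\<in>I. \<Sum>j\<in>J. p i j * cov (?A \<Otimes>\<^sub>M ?B) (\<lambda>z. u i (T z)) (\<lambda>z. v j (T z))) \<le>
      r * (sqrt (\<Sum>i\<in>I. q i * cov (?A \<Otimes>\<^sub>M ?B) (\<lambda>z. u i (T z)) (\<lambda>z. u i (T z))) *
           sqrt (\<Sum>j\<in>J. q' j * cov (?A \<Otimes>\<^sub>M ?B) (\<lambda>z. v j (T z)) (\<lambda>z. v j (T z))))"
  proof (rule weighted_cov_pair_le[where P = "P k" and P' = "P' k"])
    show "(\<Sum>i\<in>I. \<Sum>j\<in>J. p i j * cov ?A (marg (\<lambda>z. u i (T z))) (marg (\<lambda>z. v j (T z)))) \<le>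
      r * (sqrt (\<Sum>i\<in>I. q i * cov ?A (marg (\<lambda>z. u i (T z))) (marg (\<lambda>z. u i (T z)))) *
           sqrt (\<Sum>j\<in>J. q' j * cov ?A (marg (\<lambda>z. v j (T z))) (marg (\<lambda>z. v j (T z)))))"
    proof (rule insert.IH)
      show "prob_space (\<mu> l)" if "l \<in> K" for l
        using insert.prems(1) that by blast
      show "(\<Sum>i\<in>I. \<Sum>j\<in>J. p i j * (\<alpha> i * \<beta> j)) \<le>
          r * (sqrt (\<Sum>i\<in>I. q i * (\<alpha> i)\<^sup>2) * sqrt (\<Sum>j\<in>J. q' j * (\<beta> j)\<^sup>2))"
        if "l \<in> K" "\<And>i. i \<in> I \<Longrightarrow> \<not> P l i \<Longrightarrow> \<alpha> i = 0"
          "\<And>j. j \<in> J \<Longrightarrow> \<not> P' l j \<Longrightarrow> \<beta> j = 0" for l \<alpha> \<beta>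
        using insert.prems(6)[OF insertI2, OF that] .
    qed (fact sqint_marg[OF u'] sqint_marg[OF v'] u_marg v_marg)+
  next
    fix i x y y' assume *: "i \<in> I" "\<not> P k i" "x \<in> space ?A" "y \<in> space ?B" "y' \<in> space ?B"
    show "u i (T (x, y)) = u i (T (x, y'))"
      \<comment> \<open>The hypothesis is used at the point \<open>x(k := y')\<close>: overwriting
        its coordinate \<open>k\<close> by \<open>y\<close> gives \<open>x(k := y)\<close>.\<close>
      using insert.prems(4)[OF insertI1 *(1,2) spT[OF *(3,5)] *(4)]
      unfolding T_def prod.case fun_upd_upd .
  next
    fix j x y y' assume *: "j \<in> J" "\<not> P' k j" "x \<in> space ?A" "y \<in> space ?B" "y' \<in> space ?B"
    show "v j (T (x, y)) = v j (T (x, y'))"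
      using insert.prems(5)[OF insertI1 *(1,2) spT[OF *(3,5)] *(4)]
      unfolding T_def prod.case fun_upd_upd .
  qed (use r q q' u' v' insert.prems(6)[of k] in auto)
  then show ?case
    by (simp add: cov_C)
qed

section \<open>Independence of a finite-valued element, and the added point\<close>

context prob_space
begin

text \<open>Every event determined by \<open>f (U \<omega>)\<close> is already determined by
  \<open>U\<close>, so independence passes to the smaller families of events.\<close>

lemma indep_elements_compose:
  assumes ind: "indep_elements M A U B V"
    and f: "f \<in> measurable A A'" and g: "g \<in> measurable B B'"
  shows "indep_elements M A' (\<lambda>\<omega>. f (U \<omega>)) B' (\<lambda>\<omega>. g (V \<omega>))"
proof -
  have U: "U \<in> measurable M A" and V: "V \<in> measurable M B"
    and sets_indep: "indep_set {U -` E \<inter> space M | E. E \<in> sets A} {V -` E \<inter> space M | E. E \<in> sets B}"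
    using ind by (simp_all add: indep_elements_def)
  have sub: "{(\<lambda>\<omega>. h (W \<omega>)) -` E \<inter> space M | E. E \<in> sets N'} \<subseteq> {W -` E \<inter> space M | E. E \<in> sets N}"
    if "W \<in> measurable M N" "h \<in> measurable N N'"
    for W :: "'a \<Rightarrow> 'x" and h :: "'x \<Rightarrow> 'y" and N N'
  proof safe
    fix E assume "E \<in> sets N'"
    then have "h -` E \<inter> space N \<in> sets N"
      using that by (intro measurable_sets)
    moreover have "(\<lambda>\<omega>. h (W \<omega>)) -` E \<inter> space M = W -` (h -` E \<inter> space N) \<inter> space M"
      using measurable_space[OF that(1)] by auto
    ultimately show "\<exists>E'. (\<lambda>\<omega>. h (W \<omega>)) -` E \<inter> space M = W -` E' \<inter> space M \<and> E' \<in> sets N"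
      by blast
  qed
  have "indep_set {(\<lambda>\<omega>. f (U \<omega>)) -` E \<inter> space M | E. E \<in> sets A'}
      {(\<lambda>\<omega>. g (V \<omega>)) -` E \<inter> space M | E. E \<in> sets B'}"
  proof (rule indep_setI)
    show "{(\<lambda>\<omega>. f (U \<omega>)) -` E \<inter> space M | E. E \<in> sets A'} \<subseteq> events"
      using measurable_sets[OF measurable_compose[OF U f]] by auto
    show "{(\<lambda>\<omega>. g (V \<omega>)) -` E \<inter> space M | E. E \<in> sets B'} \<subseteq> events"
      using measurable_sets[OF measurable_compose[OF V g]] by auto
  qed (rule indep_setD[OF sets_indep subsetD[OF sub[OF U f]] subsetD[OF sub[OF V g]]])
  then show ?thesis
    using measurable_compose[OF U f] measurable_compose[OF V g] by (simp add: indep_elements_def)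
qed

text \<open>Functions of \<open>U\<close> and \<open>V\<close> with a common codomain type fall
  under \<open>indep_var\<close>, whose product formulas for expectations then apply.\<close>

lemma indep_var_of_indep_elements:
  fixes f :: "'b \<Rightarrow> 'd" and g :: "'c \<Rightarrow> 'd"
  assumes "indep_elements M A U B V"
    and "f \<in> measurable A A'" and "g \<in> measurable B B'"
  shows "indep_var A' (\<lambda>\<omega>. f (U \<omega>)) B' (\<lambda>\<omega>. g (V \<omega>))"
  using indep_elements_compose[OF assms] indep_elements_iff_indep_var[OF prob_space_axioms] by blast

lemma expectation_finite_valued:
  fixes h :: "'c \<Rightarrow> real"
  assumes U[measurable]: "U \<in> measurable M (count_space C)" and C: "finite C"
  shows "expectation (\<lambda>\<omega>. h (U \<omega>)) = (\<Sum>c\<in>C. prob {\<omega> \<in> space M. U \<omega> = c} * h c)"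
proof -
  have "expectation (\<lambda>\<omega>. h (U \<omega>)) =
      expectation (\<lambda>\<omega>. \<Sum>c\<in>C. indicator {\<omega> \<in> space M. U \<omega> = c} \<omega> * h c)"
  proof (intro Bochner_Integration.integral_cong refl)
    fix \<omega> assume \<omega>: "\<omega> \<in> space M"
    then have "U \<omega> \<in> C"
      using measurable_space[OF U] by simp
    then show "h (U \<omega>) = (\<Sum>c\<in>C. indicator {\<omega> \<in> space M. U \<omega> = c} \<omega> * h c)"
      using C \<omega> by (subst sum.remove[of _ "U \<omega>"]) (auto simp: indicator_def intro!: sum.neutral)
  qed
  also have "\<dots> = (\<Sum>c\<in>C. prob {\<omega> \<in> space M. U \<omega> = c} * h c)"
    by (subst Bochner_Integration.integral_sum) (auto simp: emeasure_eq_measure intro!: sum.cong)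
  finally show ?thesis .
qed

section \<open>Conditioning on an independent finite-valued element\<close>

context
  fixes C :: "'c set" and U :: "'a \<Rightarrow> 'c" and B :: "'b measure" and V :: "'a \<Rightarrow> 'b"
  assumes ind: "indep_elements M (count_space C) U B V" and C: "finite C"
begin

lemma indep_elements_measurable:
  shows "U \<in> measurable M (count_space C)" and "V \<in> measurable M B"
  using ind by (simp_all add: indep_elements_def)

lemma indicator_indep:
  fixes w :: "'b \<Rightarrow> real"
  assumes w: "integrable (distr M B V) w"
  shows "integrable M (\<lambda>\<omega>. indicator {c} (U \<omega>) * w (V \<omega>))"
    and "c \<in> C \<Longrightarrow> expectation (\<lambda>\<omega>. indicator {c} (U \<omega>) * w (V \<omega>)) =
      prob {\<omega> \<in> space M. U \<omega> = c} * (\<integral>x. w x \<partial>distr M B V)"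
proof -
  note [measurable] = indep_elements_measurable
  have [measurable]: "w \<in> borel_measurable B"
    using borel_measurable_integrable[OF w] by simp
  have iv: "indep_var borel (\<lambda>\<omega>. indicator {c} (U \<omega>)) borel (\<lambda>\<omega>. w (V \<omega>))"
    by (rule indep_var_of_indep_elements[OF ind]) simp_all
  have iw: "integrable M (\<lambda>\<omega>. w (V \<omega>))"
    using w by (simp add: integrable_distr_eq)
  have ii: "integrable M (\<lambda>\<omega>. indicator {c} (U \<omega>) :: real)"
    by (rule integrable_const_bound[where B=1]) (auto simp: indicator_def)
  show "integrable M (\<lambda>\<omega>. indicator {c} (U \<omega>) * w (V \<omega>))"
    by (rule indep_var_integrable[OF iv ii iw])
  assume "c \<in> C"
  have "expectation (\<lambda>\<omega>. indicator {c} (U \<omega>) :: real) = expectation (indicator {\<omega> \<in> space M. U \<omega> = c})"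
    by (intro Bochner_Integration.integral_cong) (auto simp: indicator_def)
  also have "\<dots> = prob {\<omega> \<in> space M. U \<omega> = c}"
    using \<open>c \<in> C\<close> by simp
  finally show "expectation (\<lambda>\<omega>. indicator {c} (U \<omega>) * w (V \<omega>)) =
      prob {\<omega> \<in> space M. U \<omega> = c} * (\<integral>x. w x \<partial>distr M B V)"
    by (simp add: indep_var_lebesgue_integral[OF iv ii iw] integral_distr)
qed

text \<open>Splitting over the finitely many values of \<open>U\<close> replaces the random section
  \<open>w (U \<omega>)\<close> by the fixed functions \<open>w c\<close>, and each piece is a
  product of an indicator in \<open>U\<close> and a function of \<open>V\<close>. Joint
  measurability of \<open>w\<close> is never an issue.\<close>

lemma decouple:
  fixes w :: "'c \<Rightarrow> 'b \<Rightarrow> real"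
  assumes w: "\<And>c. c \<in> C \<Longrightarrow> integrable (distr M B V) (w c)"
  shows integrable_decouple: "integrable M (\<lambda>\<omega>. w (U \<omega>) (V \<omega>))"
    and expectation_decouple: "expectation (\<lambda>\<omega>. w (U \<omega>) (V \<omega>)) =
      (\<Sum>c\<in>C. prob {\<omega> \<in> space M. U \<omega> = c} * (\<integral>x. w c x \<partial>distr M B V))"
proof -
  have eq: "(\<Sum>c\<in>C. indicator {c} (U \<omega>) * w c (V \<omega>)) = w (U \<omega>) (V \<omega>)" if "\<omega> \<in> space M" for \<omega>
  proof -
    have "U \<omega> \<in> C"
      using measurable_space[OF indep_elements_measurable(1) that] by simp
    then have "(\<Sum>c\<in>C. indicator {c} (U \<omega>) * w c (V \<omega>)) =
        indicator {U \<omega>} (U \<omega>) * w (U \<omega>) (V \<omega>)"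
      using C by (subst sum.remove[of _ "U \<omega>"]) (auto simp: indicator_def intro!: sum.neutral)
    then show ?thesis
      by simp
  qed
  have i: "integrable M (\<lambda>\<omega>. \<Sum>c\<in>C. indicator {c} (U \<omega>) * w c (V \<omega>))"
    by (intro Bochner_Integration.integrable_sum indicator_indep(1) w)
  then show "integrable M (\<lambda>\<omega>. w (U \<omega>) (V \<omega>))"
    using eq by (simp cong: Bochner_Integration.integrable_cong)
  have "expectation (\<lambda>\<omega>. w (U \<omega>) (V \<omega>)) =
      expectation (\<lambda>\<omega>. \<Sum>c\<in>C. indicator {c} (U \<omega>) * w c (V \<omega>))"
    using eq by (intro Bochner_Integration.integral_cong) auto
  also have "\<dots> = (\<Sum>c\<in>C. expectation (\<lambda>\<omega>. indicator {c} (U \<omega>) * w c (V \<omega>)))"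
    by (intro Bochner_Integration.integral_sum indicator_indep(1) w)
  also have "\<dots> = (\<Sum>c\<in>C. prob {\<omega> \<in> space M. U \<omega> = c} * (\<integral>x. w c x \<partial>distr M B V))"
    by (intro sum.cong refl indicator_indep(2) w)
  finally show "expectation (\<lambda>\<omega>. w (U \<omega>) (V \<omega>)) =
      (\<Sum>c\<in>C. prob {\<omega> \<in> space M. U \<omega> = c} * (\<integral>x. w c x \<partial>distr M B V))" .
qed

text \<open>The law of total covariance given \<open>U\<close>: the mean of the conditional
  covariances plus the covariance of the conditional means. By independence the conditional law of
  \<open>V\<close> is \<open>distr M B V\<close> whatever the value of \<open>U\<close>.\<close>

lemma cov_decouple:
  fixes w w' :: "'c \<Rightarrow> 'b \<Rightarrow> real"
  assumes w: "\<And>c. c \<in> C \<Longrightarrow> sqint (distr M B V) (w c)"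
    and w': "\<And>c. c \<in> C \<Longrightarrow> sqint (distr M B V) (w' c)"
  shows "cov M (\<lambda>\<omega>. w (U \<omega>) (V \<omega>)) (\<lambda>\<omega>. w' (U \<omega>) (V \<omega>)) =
      (\<Sum>c\<in>C. prob {\<omega> \<in> space M. U \<omega> = c} * cov (distr M B V) (w c) (w' c)) +
      cov M (\<lambda>\<omega>. \<integral>x. w (U \<omega>) x \<partial>distr M B V) (\<lambda>\<omega>. \<integral>x. w' (U \<omega>) x \<partial>distr M B V)"
proof -
  interpret D: prob_space "distr M B V"
    by (rule prob_space_distr[OF indep_elements_measurable(2)])
  note finite_valued = expectation_finite_valued[OF indep_elements_measurable(1) C]
  have "expectation (\<lambda>\<omega>. w (U \<omega>) (V \<omega>)) = expectation (\<lambda>\<omega>. \<integral>x. w (U \<omega>) x \<partial>distr M B V)"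
    using expectation_decouple[of w] D.sqint_integrable[OF w]
      finite_valued[of "\<lambda>c. \<integral>x. w c x \<partial>distr M B V"] by simp
  moreover have "expectation (\<lambda>\<omega>. w' (U \<omega>) (V \<omega>)) = expectation (\<lambda>\<omega>. \<integral>x. w' (U \<omega>) x \<partial>distr M B V)"
    using expectation_decouple[of w'] D.sqint_integrable[OF w']
      finite_valued[of "\<lambda>c. \<integral>x. w' c x \<partial>distr M B V"] by simp
  moreover have "expectation (\<lambda>\<omega>. w (U \<omega>) (V \<omega>) * w' (U \<omega>) (V \<omega>)) =
      (\<Sum>c\<in>C. prob {\<omega> \<in> space M. U \<omega> = c} * (\<integral>x. w c x * w' c x \<partial>distr M B V))"
    by (rule expectation_decouple[of "\<lambda>c x. w c x * w' c x"]) (intro sqint_mult_integrable w w')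
  ultimately show ?thesis
    using finite_valued[of "\<lambda>c. (\<integral>x. w c x \<partial>distr M B V) * (\<integral>x. w' c x \<partial>distr M B V)"]
    by (simp add: cov_def right_diff_distrib sum_subtractf)
qed

lemma sqint_decouple:
  fixes w :: "'c \<Rightarrow> 'b \<Rightarrow> real"
  assumes w: "\<And>c. c \<in> C \<Longrightarrow> sqint (distr M B V) (w c)"
  shows "sqint M (\<lambda>\<omega>. w (U \<omega>) (V \<omega>))"
proof -
  interpret D: prob_space "distr M B V"
    by (rule prob_space_distr[OF indep_elements_measurable(2)])
  have "integrable M (\<lambda>\<omega>. w (U \<omega>) (V \<omega>))"
    by (rule integrable_decouple) (intro D.sqint_integrable w)
  moreover have "integrable M (\<lambda>\<omega>. (w (U \<omega>) (V \<omega>))\<^sup>2)"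
    using w by (intro integrable_decouple[of "\<lambda>c x. (w c x)\<^sup>2"]) (simp add: sqint_def)
  ultimately show ?thesis
    by (simp add: sqint_def)
qed

text \<open>By independence, \<open>prob {\<omega> \<in> space M. U \<omega> = c}\<close> times the
  second moment of \<open>w c (V \<omega>)\<close> is the contribution of the event
  \<open>U = c\<close> to the second moment of the whole, hence finite; the first factor is
  positive. The integrals are nonnegative extended ones because finiteness is what has to be
  proved.\<close>

lemma sqint_section:
  fixes w :: "'c \<Rightarrow> 'b \<Rightarrow> real"
  assumes w: "\<And>c. c \<in> C \<Longrightarrow> w c \<in> borel_measurable B"
    and sq: "sqint M (\<lambda>\<omega>. w (U \<omega>) (V \<omega>))"
    and c: "c \<in> C" "prob {\<omega> \<in> space M. U \<omega> = c} \<noteq> 0"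
  shows "sqint (distr M B V) (w c)"
proof -
  note [measurable] = indep_elements_measurable w[OF c(1)]
  have iv: "indep_var borel (\<lambda>\<omega>. indicator {c} (U \<omega>)) borel (\<lambda>\<omega>. ennreal ((w c (V \<omega>))\<^sup>2))"
    by (rule indep_var_of_indep_elements[OF ind]) simp_all
  \<comment> \<open>\<open>indep_var\<close> unfolds to a family over \<open>bool\<close>; its
    codomains have to be recognized as a constant family before the product formula for nonnegative
    integrals applies.\<close>
  have "case_bool borel borel = (\<lambda>_. borel :: ennreal measure)"
    by (auto simp: fun_eq_iff split: bool.split)
  with iv have ivs: "indep_vars (\<lambda>_. borel)
      (case_bool (\<lambda>\<omega>. indicator {c} (U \<omega>)) (\<lambda>\<omega>. ennreal ((w c (V \<omega>))\<^sup>2))) UNIV"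
    by (simp add: indep_var_def)
  have "(\<integral>\<^sup>+\<omega>. indicator {c} (U \<omega>) * ennreal ((w c (V \<omega>))\<^sup>2) \<partial>M) =
      (\<integral>\<^sup>+\<omega>. indicator {c} (U \<omega>) \<partial>M) * (\<integral>\<^sup>+\<omega>. ennreal ((w c (V \<omega>))\<^sup>2) \<partial>M)"
    using indep_vars_nn_integral[OF _ ivs] by (simp add: UNIV_bool mult.commute)
  moreover have "(\<integral>\<^sup>+\<omega>. indicator {c} (U \<omega>) \<partial>M) = emeasure M {\<omega> \<in> space M. U \<omega> = c}"
  proof -
    have "(\<integral>\<^sup>+\<omega>. indicator {c} (U \<omega>) \<partial>M) = (\<integral>\<^sup>+\<omega>. indicator {\<omega> \<in> space M. U \<omega> = c} \<omega> \<partial>M)"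
      by (intro nn_integral_cong) (auto simp: indicator_def)
    then show ?thesis
      using c(1) by simp
  qed
  moreover have "emeasure M {\<omega> \<in> space M. U \<omega> = c} \<noteq> 0"
    using c(2) by (auto simp: measure_def)
  moreover have "(\<integral>\<^sup>+\<omega>. indicator {c} (U \<omega>) * ennreal ((w c (V \<omega>))\<^sup>2) \<partial>M) < \<infinity>"
  proof -
    have "(\<integral>\<^sup>+\<omega>. indicator {c} (U \<omega>) * ennreal ((w c (V \<omega>))\<^sup>2) \<partial>M) \<le>
        (\<integral>\<^sup>+\<omega>. ennreal (norm ((w (U \<omega>) (V \<omega>))\<^sup>2)) \<partial>M)"
      by (intro nn_integral_mono) (auto simp: indicator_def)
    also have "\<dots> < \<infinity>"
      using sq by (simp add: sqint_def integrable_iff_bounded)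
    finally show ?thesis .
  qed
  ultimately have "(\<integral>\<^sup>+\<omega>. ennreal ((w c (V \<omega>))\<^sup>2) \<partial>M) < \<infinity>"
    by (auto simp: ennreal_mult_less_top)
  then have "integrable M (\<lambda>\<omega>. (w c (V \<omega>))\<^sup>2)"
    by (simp add: integrable_iff_bounded)
  then show ?thesis
    by (simp add: sqint_def integrable_distr_eq)
qed

end

end

section \<open>The measurable space with the added point\<close>

lemma space_add_point: "space (add_point F) = insert None (Some ` space F)"
  by (simp add: add_point_def space_measure_of_conv)

lemma sets_add_point:
  "sets (add_point F) = sigma_sets (insert None (Some ` space F)) (insert {None} ((\<lambda>A. Some ` A) ` sets F))"
  unfolding add_point_def by (rule sets_measure_of) (use sets.sets_into_space[of _ F] in auto)

lemma singleton_None_sets_add_point[measurable]: "{None} \<in> sets (add_point F)"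
  unfolding sets_add_point by (rule sigma_sets.Basic) simp

lemma Some_image_sets_add_point: "A \<in> sets F \<Longrightarrow> Some ` A \<in> sets (add_point F)"
  unfolding sets_add_point by (rule sigma_sets.Basic) simp

lemma measurable_Some_add_point[measurable]: "Some \<in> measurable F (add_point F)"
  unfolding add_point_def
proof (rule measurable_measure_of)
  fix E assume "E \<in> insert {None} ((\<lambda>A. Some ` A) ` sets F)"
  then consider "E = {None}" | A where "A \<in> sets F" "E = Some ` A"
    by auto
  then show "Some -` E \<inter> space F \<in> sets F"
  proof cases
    case 1
    then have "Some -` E \<inter> space F = {}"
      by blast
    then show ?thesis
      by (metis sets.empty_sets)
  next
    case 2
    then have "Some -` E \<inter> space F = A"
      using sets.sets_into_space by auto
    with 2 show ?thesis
      by simp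
  qed
next
  show "insert {None} ((\<lambda>A. Some ` A) ` sets F) \<subseteq> Pow (insert None (Some ` space F))"
    using sets.sets_into_space[of _ F] by blast
  show "Some \<in> space F \<rightarrow> insert None (Some ` space F)"
    by simp
qed

text \<open>A preimage consists of its part at the added point, which is \<open>{None}\<close> or
  empty, and the \<open>Some\<close>-image of a measurable set. Test functions of a masked entry are
  built this way, with value 0 at \<open>None\<close>.\<close>

lemma measurable_case_option_add_point[measurable (raw)]:
  assumes f: "f \<in> measurable F N" and c: "c \<in> space N"
  shows "case_option c f \<in> measurable (add_point F) N"
proof (rule measurableI)
  fix x assume "x \<in> space (add_point F)"
  then show "case_option c f x \<in> space N"
    using c measurable_space[OF f] by (auto simp: space_add_point)
next
  fix E assume "E \<in> sets N"
  then have "Some ` (f -` E \<inter> space F) \<in> sets (add_point F)"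
    by (intro Some_image_sets_add_point measurable_sets[OF f])
  moreover have "case_option c f -` E \<inter> space (add_point F) =
      (if c \<in> E then {None} else {}) \<union> Some ` (f -` E \<inter> space F)"
    by (auto simp: space_add_point)
  moreover have "(if c \<in> E then {None} else {}) \<in> sets (add_point F)"
    by simp
  ultimately show "case_option c f -` E \<inter> space (add_point F) \<in> sets (add_point F)"
    by (simp only: sets.Un)
qed

text \<open>There are finitely many possible supports, so preimages of singletons suffice, and each
  is given by finitely many conditions on single coordinates.\<close>

lemma measurable_support_add_point:
  "(\<lambda>y. {i \<in> {1..n}. y i \<noteq> None}) \<in> measurable (\<Pi>\<^sub>M i\<in>{1..n}. add_point F) (subset_space n)"
  unfolding subset_space_def
proof (subst measurable_count_space_eq2)
  show "(\<lambda>y. {i \<in> {1..n}. y i \<noteq> None}) \<in> space (\<Pi>\<^sub>M i\<in>{1..n}. add_point F) \<rightarrow> Pow {1..n} \<and>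
    (\<forall>s\<in>Pow {1..n}. (\<lambda>y. {i \<in> {1..n}. y i \<noteq> None}) -` {s} \<inter> space (\<Pi>\<^sub>M i\<in>{1..n}. add_point F)
      \<in> sets (\<Pi>\<^sub>M i\<in>{1..n}. add_point F))"
  proof (intro conjI ballI)
    fix s assume "s \<in> Pow {1..n}"
    have None_iff: "{y \<in> space (\<Pi>\<^sub>M i\<in>{1..n}. add_point F). y i \<noteq> None \<longleftrightarrow> i \<in> s} \<in> sets (\<Pi>\<^sub>M i\<in>{1..n}. add_point F)"
      if "i \<in> {1..n}" for i
    proof -
      have "{y \<in> space (\<Pi>\<^sub>M i\<in>{1..n}. add_point F). y i \<in> {None}} \<in> sets (\<Pi>\<^sub>M i\<in>{1..n}. add_point F)"
        by (rule sets_Collect_single) (use that in simp_all)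
      from this sets.sets_Collect_neg[OF this] show ?thesis
        by (cases "i \<in> s") simp_all
    qed
    have eq: "{i \<in> {1..n}. y i \<noteq> None} = s \<longleftrightarrow> (\<forall>i\<in>{1..n}. y i \<noteq> None \<longleftrightarrow> i \<in> s)"
      for y :: "nat \<Rightarrow> 'a option"
      using \<open>s \<in> Pow {1..n}\<close> by blast
    have "(\<lambda>y. {i \<in> {1..n}. y i \<noteq> None}) -` {s} \<inter> space (\<Pi>\<^sub>M i\<in>{1..n}. add_point F) =
      {y \<in> space (\<Pi>\<^sub>M i\<in>{1..n}. add_point F). \<forall>i\<in>{1..n}. y i \<noteq> None \<longleftrightarrow> i \<in> s}"
      unfolding vimage_def Int_def mem_Collect_eq singleton_iff eq
      by (rule Collect_cong) (rule conj_commute)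
    also have "\<dots> \<in> sets (\<Pi>\<^sub>M i\<in>{1..n}. add_point F)"
      by (intro sets.sets_Collect_finite_All None_iff) auto
    finally show "(\<lambda>y. {i \<in> {1..n}. y i \<noteq> None}) -` {s} \<inter> space (\<Pi>\<^sub>M i\<in>{1..n}. add_point F)
      \<in> sets (\<Pi>\<^sub>M i\<in>{1..n}. add_point F)" .
  qed auto
qed auto

section \<open>Random subsets\<close>

locale random_subsets = prob_space M for M :: "'w measure" +
  fixes n :: nat and S T :: "'w \<Rightarrow> nat set"
  assumes S_meas: "S \<in> measurable M (subset_space n)"
    and T_meas: "T \<in> measurable M (subset_space n)"
begin

lemma S_count[measurable]: "S \<in> measurable M (count_space (Pow {1..n}))"
  using S_meas by (simp add: subset_space_def)

lemma T_count[measurable]: "T \<in> measurable M (count_space (Pow {1..n}))"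
  using T_meas by (simp add: subset_space_def)

text \<open>The pair \<open>(S, T)\<close> thus takes values in a finite discrete space, as the
  decoupling lemmas require.\<close>

lemma pair_space_eq:
  "subset_space n \<Otimes>\<^sub>M subset_space n = count_space (Pow {1..n} \<times> Pow {1..n})"
  unfolding subset_space_def by (rule pair_measure_count_space) simp_all

lemma ST_count: "(\<lambda>\<omega>. (S \<omega>, T \<omega>)) \<in> measurable M (count_space (Pow {1..n} \<times> Pow {1..n}))"
  using measurable_Pair[OF S_meas T_meas] by (simp add: pair_space_eq)

lemma expectation_S:
  fixes h :: "nat set \<Rightarrow> real"
  shows "expectation (\<lambda>\<omega>. h (S \<omega>)) = (\<Sum>s\<in>Pow {1..n}. prob {\<omega> \<in> space M. S \<omega> = s} * h s)"
  by (rule expectation_finite_valued[OF S_count]) simp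

lemma expectation_T:
  fixes h :: "nat set \<Rightarrow> real"
  shows "expectation (\<lambda>\<omega>. h (T \<omega>)) = (\<Sum>t\<in>Pow {1..n}. prob {\<omega> \<in> space M. T \<omega> = t} * h t)"
  by (rule expectation_finite_valued[OF T_count]) simp

lemma expectation_ST:
  fixes h :: "nat set \<Rightarrow> nat set \<Rightarrow> real"
  shows "expectation (\<lambda>\<omega>. h (S \<omega>) (T \<omega>)) = (\<Sum>s\<in>Pow {1..n}. \<Sum>t\<in>Pow {1..n}.
    prob {\<omega> \<in> space M. S \<omega> = s \<and> T \<omega> = t} * h s t)"
  using expectation_finite_valued[OF ST_count, of "\<lambda>(s, t). h s t"]
  by (simp add: sum.cartesian_product case_prod_beta prod_eq_iff)

lemma sqint_S: "sqint M (\<lambda>\<omega>. h (S \<omega>))"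
proof (rule sqint_bounded)
  show "\<bar>h (S \<omega>)\<bar> \<le> (\<Sum>s\<in>Pow {1..n}. \<bar>h s\<bar>)" if "\<omega> \<in> space M" for \<omega>
    using measurable_space[OF S_count that] by (intro member_le_sum) auto
qed (rule measurable_compose[OF S_count], simp)

lemma sqint_T: "sqint M (\<lambda>\<omega>. h (T \<omega>))"
proof (rule sqint_bounded)
  show "\<bar>h (T \<omega>)\<bar> \<le> (\<Sum>s\<in>Pow {1..n}. \<bar>h s\<bar>)" if "\<omega> \<in> space M" for \<omega>
    using measurable_space[OF T_count that] by (intro member_le_sum) auto
qed (rule measurable_compose[OF T_count], simp)

text \<open>Extending \<open>\<alpha>\<close> and \<open>\<beta>\<close> by zero to the sets that do not contain \<open>j\<close> turns the sums in
  \<^const>\<open>best_const\<close> into expectations.\<close>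

definition admissible :: "nat \<Rightarrow> real \<Rightarrow> bool" where
  "admissible j r \<longleftrightarrow> 0 \<le> r \<and> (\<forall>\<alpha> \<beta>. (\<forall>s. j \<notin> s \<longrightarrow> \<alpha> s = 0) \<longrightarrow> (\<forall>t. j \<notin> t \<longrightarrow> \<beta> t = 0) \<longrightarrow>
     expectation (\<lambda>\<omega>. \<alpha> (S \<omega>) * \<beta> (T \<omega>)) \<le>
       r * (sqrt (expectation (\<lambda>\<omega>. (\<alpha> (S \<omega>))\<^sup>2)) * sqrt (expectation (\<lambda>\<omega>. (\<beta> (T \<omega>))\<^sup>2))))"

lemma best_const_eq: "best_const M n S T j = (LEAST r. admissible j r)"
proof -
  define cut where "cut \<alpha> s = (if j \<in> s then \<alpha> s else 0)" for \<alpha> :: "nat set \<Rightarrow> real" and s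
  have lhs: "(\<Sum>(s, t) | s \<subseteq> {1..n} \<and> t \<subseteq> {1..n} \<and> j \<in> s \<inter> t.
      prob {\<omega> \<in> space M. S \<omega> = s \<and> T \<omega> = t} * \<alpha> s * \<beta> t) =
      expectation (\<lambda>\<omega>. cut \<alpha> (S \<omega>) * cut \<beta> (T \<omega>))" for \<alpha> \<beta>
    unfolding expectation_ST[of "\<lambda>s t. cut \<alpha> s * cut \<beta> t"] sum.cartesian_product
    by (rule sum.mono_neutral_cong_left) (auto simp: cut_def split: if_splits)
  have rhs_S: "(\<Sum>s | s \<subseteq> {1..n} \<and> j \<in> s. prob {\<omega> \<in> space M. S \<omega> = s} * (\<alpha> s)\<^sup>2) =
      expectation (\<lambda>\<omega>. (cut \<alpha> (S \<omega>))\<^sup>2)" for \<alpha>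
    unfolding expectation_S[of "\<lambda>s. (cut \<alpha> s)\<^sup>2"]
    by (rule sum.mono_neutral_cong_left) (auto simp: cut_def)
  have rhs_T: "(\<Sum>s | s \<subseteq> {1..n} \<and> j \<in> s. prob {\<omega> \<in> space M. T \<omega> = s} * (\<alpha> s)\<^sup>2) =
      expectation (\<lambda>\<omega>. (cut \<alpha> (T \<omega>))\<^sup>2)" for \<alpha>
    unfolding expectation_T[of "\<lambda>s. (cut \<alpha> s)\<^sup>2"]
    by (rule sum.mono_neutral_cong_left) (auto simp: cut_def)
  have cut_id: "cut \<alpha> = \<alpha>" if "\<forall>s. j \<notin> s \<longrightarrow> \<alpha> s = 0" for \<alpha>
    using that by (auto simp: cut_def fun_eq_iff)
  have cut_zero: "\<forall>s. j \<notin> s \<longrightarrow> cut \<alpha> s = 0" for \<alpha>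
    by (simp add: cut_def)
  \<comment> \<open>The range of \<open>cut\<close> is exactly the set of functions that vanish on
    every set without \<open>j\<close>, by \<open>cut_zero\<close> and \<open>cut_id\<close>;
    quantifying over truncations is quantifying over such functions.\<close>
  have cut_all: "(\<forall>\<alpha> \<beta>. Q (cut \<alpha>) (cut \<beta>)) \<longleftrightarrow>
      (\<forall>\<alpha> \<beta>. (\<forall>s. j \<notin> s \<longrightarrow> \<alpha> s = 0) \<longrightarrow> (\<forall>t. j \<notin> t \<longrightarrow> \<beta> t = 0) \<longrightarrow> Q \<alpha> \<beta>)" for Q
  proof (intro iffI allI impI)
    fix \<alpha> \<beta> :: "nat set \<Rightarrow> real"
    assume "\<forall>\<alpha> \<beta>. Q (cut \<alpha>) (cut \<beta>)" "\<forall>s. j \<notin> s \<longrightarrow> \<alpha> s = 0" "\<forall>t. j \<notin> t \<longrightarrow> \<beta> t = 0"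
    then show "Q \<alpha> \<beta>"
      using cut_id[of \<alpha>] cut_id[of \<beta>] by metis
  qed (use cut_zero in simp)
  show ?thesis
    unfolding best_const_def lhs rhs_S rhs_T admissible_def
    unfolding mult.assoc cut_all[of "\<lambda>\<alpha> \<beta>. expectation (\<lambda>\<omega>. \<alpha> (S \<omega>) * \<beta> (T \<omega>)) \<le> r *
        (sqrt (expectation (\<lambda>\<omega>. (\<alpha> (S \<omega>))\<^sup>2)) * sqrt (expectation (\<lambda>\<omega>. (\<beta> (T \<omega>))\<^sup>2)))" for r] ..
qed

lemma admissible_one: "admissible j 1"
proof -
  have "expectation (\<lambda>\<omega>. \<alpha> (S \<omega>) * \<beta> (T \<omega>)) \<le>
      sqrt (expectation (\<lambda>\<omega>. (\<alpha> (S \<omega>))\<^sup>2)) * sqrt (expectation (\<lambda>\<omega>. (\<beta> (T \<omega>))\<^sup>2))" for \<alpha> \<beta>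
    using integral_Cauchy_Schwarz_sqrt[OF sqint_S[of \<alpha>] sqint_T[of \<beta>]] by linarith
  then show ?thesis
    by (simp add: admissible_def)
qed

text \<open>\<open>LEAST\<close> over the reals says something only if the infimum is attained. It
  is, because each pair \<open>\<alpha>\<close>, \<open>\<beta>\<close> imposes a closed condition
  \<open>?L \<le> r * ?d\<close> on \<open>r\<close>.\<close>

lemma admissible_best_const: "admissible j (best_const M n S T j)"
  and best_const_le: "admissible j r \<Longrightarrow> best_const M n S T j \<le> r"
proof -
  define R where "R = {r. admissible j r}"
  have ne: "R \<noteq> {}"
    using admissible_one[of j] by (auto simp: R_def)
  have bdd: "bdd_below R"
    by (rule bdd_belowI[of _ 0]) (simp add: R_def admissible_def)
  have lower: "Inf R \<le> r" if "admissible j r" for r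
    using that bdd by (intro cInf_lower) (auto simp: R_def)
  have "admissible j (Inf R)"
    unfolding admissible_def
  proof (intro conjI allI impI)
    show "0 \<le> Inf R"
      using ne by (intro cInf_greatest) (auto simp: R_def admissible_def)
    fix \<alpha> \<beta> :: "nat set \<Rightarrow> real"
    assume \<alpha>: "\<forall>s. j \<notin> s \<longrightarrow> \<alpha> s = 0" and \<beta>: "\<forall>t. j \<notin> t \<longrightarrow> \<beta> t = 0"
    let ?L = "expectation (\<lambda>\<omega>. \<alpha> (S \<omega>) * \<beta> (T \<omega>))"
    let ?d = "sqrt (expectation (\<lambda>\<omega>. (\<alpha> (S \<omega>))\<^sup>2)) * sqrt (expectation (\<lambda>\<omega>. (\<beta> (T \<omega>))\<^sup>2))"
    have le: "?L \<le> r * ?d" if "r \<in> R" for r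
      using that \<alpha> \<beta> by (simp add: R_def admissible_def)
    have "0 \<le> ?d"
      by simp
    show "?L \<le> Inf R * ?d"
    \<comment> \<open>With \<open>?d = 0\<close> the inequality does not restrict \<open>r\<close>,
      and any one admissible constant already yields \<open>?L \<le> 0\<close>.\<close>
    proof (cases "?d = 0")
      case True
      then show ?thesis
        using le ne by auto
    next
      case False
      with \<open>0 \<le> ?d\<close> have d: "0 < ?d"
        by linarith
      have "?L / ?d \<le> Inf R"
      proof (rule cInf_greatest[OF ne])
        fix r assume "r \<in> R"
        from le[OF this] d show "?L / ?d \<le> r"
          by (simp only: pos_divide_le_eq)
      qed
      with d show ?thesis
        by (simp only: pos_divide_le_eq)
    qed
  qed
  then have "best_const M n S T j = Inf R"
    unfolding best_const_eq by (rule Least_equality) (rule lower)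
  with \<open>admissible j (Inf R)\<close> lower
  show "admissible j (best_const M n S T j)" "admissible j r \<Longrightarrow> best_const M n S T j \<le> r"
    by simp_all
qed

lemma best_const_nonneg: "0 \<le> best_const M n S T j"
  using admissible_best_const[of j] by (simp add: admissible_def)

section \<open>The case of independent subsets\<close>

lemma max_corr_indep:
  assumes "indep_var (subset_space n) S (subset_space n) T"
  shows "max_corr M (subset_space n) S (subset_space n) T = 0"
proof (rule antisym[OF max_corr_least max_corr_nonneg])
  fix \<phi> \<psi> :: "nat set \<Rightarrow> real"
  assume [measurable]: "\<phi> \<in> borel_measurable (subset_space n)" "\<psi> \<in> borel_measurable (subset_space n)"
  have "indep_var borel (\<phi> \<circ> S) borel (\<psi> \<circ> T)"
    by (rule indep_var_compose[OF assms]) simp_all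
  then have "cov M (\<lambda>\<omega>. \<phi> (S \<omega>)) (\<lambda>\<omega>. \<psi> (T \<omega>)) = 0"
    using indep_var_lebesgue_integral[of "\<phi> \<circ> S" "\<psi> \<circ> T"]
      sqint_integrable[OF sqint_S[of \<phi>]] sqint_integrable[OF sqint_T[of \<psi>]]
    by (simp add: cov_def o_def)
  then show "cov M (\<lambda>\<omega>. \<phi> (S \<omega>)) (\<lambda>\<omega>. \<psi> (T \<omega>)) \<le> 0 *
      sqrt (cov M (\<lambda>\<omega>. \<phi> (S \<omega>)) (\<lambda>\<omega>. \<phi> (S \<omega>))) * sqrt (cov M (\<lambda>\<omega>. \<psi> (T \<omega>)) (\<lambda>\<omega>. \<psi> (T \<omega>)))"
    by simp
qed (use S_meas T_meas in auto)

text \<open>The bilinear form factors into two means. As \<open>\<alpha>\<close> equals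
  \<open>\<alpha> * e\<close>, with \<open>e\<close> the indicator of \<open>j \<in> s\<close>,
  Cauchy-Schwarz bounds the mean of \<open>\<alpha> (S \<omega>)\<close> with the factor
  \<open>sqrt a\<close>, and likewise \<open>\<beta>\<close> with \<open>sqrt b\<close>. The choice
  \<open>\<alpha> = \<beta> = e\<close> gives the lower bound.\<close>

lemma best_const_indep:
  assumes "indep_var (subset_space n) S (subset_space n) T"
  shows "best_const M n S T j =
    sqrt (prob {\<omega> \<in> space M. j \<in> S \<omega>} * prob {\<omega> \<in> space M. j \<in> T \<omega>})"
proof -
  define a b where "a = prob {\<omega> \<in> space M. j \<in> S \<omega>}" and "b = prob {\<omega> \<in> space M. j \<in> T \<omega>}"
  define e :: "nat set \<Rightarrow> real" where "e s = of_bool (j \<in> s)" for s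
  have [simp]: "(e s)\<^sup>2 = e s" for s
    by (simp add: e_def)
  have e_zero: "\<forall>s. j \<notin> s \<longrightarrow> e s = 0"
    by (simp add: e_def)
  have "expectation (\<lambda>\<omega>. e (S \<omega>)) = expectation (indicator {\<omega> \<in> space M. j \<in> S \<omega>})"
    by (intro Bochner_Integration.integral_cong) (auto simp: e_def indicator_def)
  then have a: "expectation (\<lambda>\<omega>. e (S \<omega>)) = a"
    by (auto simp: a_def intro!: arg_cong[where f=prob])
  have "expectation (\<lambda>\<omega>. e (T \<omega>)) = expectation (indicator {\<omega> \<in> space M. j \<in> T \<omega>})"
    by (intro Bochner_Integration.integral_cong) (auto simp: e_def indicator_def)
  then have b: "expectation (\<lambda>\<omega>. e (T \<omega>)) = b"
    by (auto simp: b_def intro!: arg_cong[where f=prob])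
  have prod: "expectation (\<lambda>\<omega>. \<alpha> (S \<omega>) * \<beta> (T \<omega>)) = expectation (\<lambda>\<omega>. \<alpha> (S \<omega>)) * expectation (\<lambda>\<omega>. \<beta> (T \<omega>))"
    for \<alpha> \<beta> :: "nat set \<Rightarrow> real"
  proof -
    have "indep_var borel (\<alpha> \<circ> S) borel (\<beta> \<circ> T)"
      by (rule indep_var_compose[OF assms]) (simp_all add: subset_space_def)
    then show ?thesis
      using indep_var_lebesgue_integral[of "\<alpha> \<circ> S" "\<beta> \<circ> T"]
        sqint_integrable[OF sqint_S[of \<alpha>]] sqint_integrable[OF sqint_T[of \<beta>]]
      by (simp add: o_def)
  qed
  have "admissible j (sqrt (a * b))"
    unfolding admissible_def
  proof (intro conjI allI impI)
    show "0 \<le> sqrt (a * b)"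
      by (simp add: a_def b_def)
    fix \<alpha> \<beta> :: "nat set \<Rightarrow> real"
    assume \<alpha>: "\<forall>s. j \<notin> s \<longrightarrow> \<alpha> s = 0" and \<beta>: "\<forall>t. j \<notin> t \<longrightarrow> \<beta> t = 0"
    have e_id: "\<alpha> s * e s = \<alpha> s" "\<beta> s * e s = \<beta> s" for s
      using \<alpha> \<beta> by (auto simp: e_def)
    have "\<bar>expectation (\<lambda>\<omega>. \<alpha> (S \<omega>))\<bar> \<le> sqrt (expectation (\<lambda>\<omega>. (\<alpha> (S \<omega>))\<^sup>2)) * sqrt a"
      "\<bar>expectation (\<lambda>\<omega>. \<beta> (T \<omega>))\<bar> \<le> sqrt (expectation (\<lambda>\<omega>. (\<beta> (T \<omega>))\<^sup>2)) * sqrt b"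
      using integral_Cauchy_Schwarz_sqrt[OF sqint_S[of \<alpha>] sqint_S[of e]]
        integral_Cauchy_Schwarz_sqrt[OF sqint_T[of \<beta>] sqint_T[of e]]
      unfolding e_id by (simp_all add: a b)
    from mult_mono[OF this]
    have "\<bar>expectation (\<lambda>\<omega>. \<alpha> (S \<omega>)) * expectation (\<lambda>\<omega>. \<beta> (T \<omega>))\<bar> \<le>
        (sqrt (expectation (\<lambda>\<omega>. (\<alpha> (S \<omega>))\<^sup>2)) * sqrt a) * (sqrt (expectation (\<lambda>\<omega>. (\<beta> (T \<omega>))\<^sup>2)) * sqrt b)"
      by (simp add: abs_mult a_def b_def)
    then show "expectation (\<lambda>\<omega>. \<alpha> (S \<omega>) * \<beta> (T \<omega>)) \<le> sqrt (a * b) *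
        (sqrt (expectation (\<lambda>\<omega>. (\<alpha> (S \<omega>))\<^sup>2)) * sqrt (expectation (\<lambda>\<omega>. (\<beta> (T \<omega>))\<^sup>2)))"
      unfolding prod by (simp add: real_sqrt_mult mult_ac)
  qed
  moreover have "sqrt (a * b) \<le> best_const M n S T j"
  proof -
    have ab0: "0 \<le> a * b"
      by (simp add: a_def b_def)
    have "expectation (\<lambda>\<omega>. e (S \<omega>) * e (T \<omega>)) \<le> best_const M n S T j *
       (sqrt (expectation (\<lambda>\<omega>. (e (S \<omega>))\<^sup>2)) * sqrt (expectation (\<lambda>\<omega>. (e (T \<omega>))\<^sup>2)))"
      using admissible_best_const[of j] e_zero unfolding admissible_def by blast
    then have "a * b \<le> best_const M n S T j * sqrt (a * b)"
      by (simp add: prod a b real_sqrt_mult)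
    \<comment> \<open>Writing \<open>a * b\<close> as a square lets one factor
      \<open>sqrt (a * b)\<close> cancel; if it is 0, nonnegativity of the best constant
      suffices.\<close>
    then have "sqrt (a * b) * sqrt (a * b) \<le> best_const M n S T j * sqrt (a * b)"
      using ab0 by simp
    then show ?thesis
      using best_const_nonneg[of j] ab0
      by (metis mult_right_le_imp_le order_le_less real_sqrt_ge_zero)
  qed
  ultimately show ?thesis
    using best_const_le[of j "sqrt (a * b)"] by (simp add: a_def b_def)
qed

end

section \<open>Randomly masked vectors\<close>

locale masked_vector = random_subsets M n S T
  for M :: "'w measure" and n :: nat and S T :: "'w \<Rightarrow> nat set" +
  fixes F :: "'a measure" and X :: "nat \<Rightarrow> 'w \<Rightarrow> 'a" and Y Z :: "nat \<Rightarrow> 'w \<Rightarrow> 'a option"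
  assumes n: "1 \<le> n"
    and X_indep: "indep_vars (\<lambda>_. F) X {1..n}"
    and X_nondegenerate: "\<And>i. i \<in> {1..n} \<Longrightarrow> \<not> degenerate M F (X i)"
    and ST_X_indep: "indep_elements M (subset_space n \<Otimes>\<^sub>M subset_space n) (\<lambda>\<omega>. (S \<omega>, T \<omega>))
           (\<Pi>\<^sub>M i\<in>{1..n}. F) (\<lambda>\<omega>. \<lambda>i\<in>{1..n}. X i \<omega>)"
    and Y: "\<And>i \<omega>. \<lbrakk>i \<in> {1..n}; \<omega> \<in> space M\<rbrakk> \<Longrightarrow> Y i \<omega> = (if i \<in> S \<omega> then Some (X i \<omega>) else None)"
    and Z: "\<And>i \<omega>. \<lbrakk>i \<in> {1..n}; \<omega> \<in> space M\<rbrakk> \<Longrightarrow> Z i \<omega> = (if i \<in> T \<omega> then Some (X i \<omega>) else None)"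
begin

declare One_nat_def[simp del]

abbreviation Xv :: "'w \<Rightarrow> nat \<Rightarrow> 'a" where "Xv \<omega> \<equiv> (\<lambda>i\<in>{1..n}. X i \<omega>)"
abbreviation Yv :: "'w \<Rightarrow> nat \<Rightarrow> 'a option" where "Yv \<omega> \<equiv> (\<lambda>i\<in>{1..n}. Y i \<omega>)"
abbreviation Zv :: "'w \<Rightarrow> nat \<Rightarrow> 'a option" where "Zv \<omega> \<equiv> (\<lambda>i\<in>{1..n}. Z i \<omega>)"
abbreviation FX :: "(nat \<Rightarrow> 'a) measure" where "FX \<equiv> \<Pi>\<^sub>M i\<in>{1..n}. F"
abbreviation FY :: "(nat \<Rightarrow> 'a option) measure" where "FY \<equiv> \<Pi>\<^sub>M i\<in>{1..n}. add_point F"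
abbreviation PX :: "(nat \<Rightarrow> 'a) measure" where "PX \<equiv> distr M FX Xv"

text \<open>Writing \<open>Y\<close> as \<open>mask S X\<close> and \<open>Z\<close> as
  \<open>mask T X\<close> exhibits them as functions of a finite-valued element and an independent
  vector, the form that decoupling needs.\<close>

definition mask :: "nat set \<Rightarrow> (nat \<Rightarrow> 'a) \<Rightarrow> nat \<Rightarrow> 'a option" where
  "mask s x = (\<lambda>i\<in>{1..n}. if i \<in> s then Some (x i) else None)"

definition supp :: "(nat \<Rightarrow> 'a option) \<Rightarrow> nat set" where
  "supp y = {i \<in> {1..n}. y i \<noteq> None}"

lemma X_meas: "i \<in> {1..n} \<Longrightarrow> X i \<in> measurable M F"
  using X_indep by (simp add: indep_vars_def)

lemma Xv_meas[measurable]: "Xv \<in> measurable M FX"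
  by (intro measurable_restrict X_meas)

lemma S_subset: "\<omega> \<in> space M \<Longrightarrow> S \<omega> \<subseteq> {1..n}"
  using measurable_space[OF S_count] by auto

lemma T_subset: "\<omega> \<in> space M \<Longrightarrow> T \<omega> \<subseteq> {1..n}"
  using measurable_space[OF T_count] by auto

lemma masked_measurable:
  assumes i: "i \<in> {1..n}" and U: "U \<in> measurable M (count_space (Pow {1..n}))"
  shows "(\<lambda>\<omega>. if i \<in> U \<omega> then Some (X i \<omega>) else None) \<in> measurable M (add_point F)"
proof (rule measurable_If)
  have "(\<lambda>\<omega>. i \<in> U \<omega>) \<in> measurable M (count_space UNIV)"
    by (rule measurable_compose[OF U]) simp
  then show "{\<omega> \<in> space M. i \<in> U \<omega>} \<in> sets M"
    by simp
  show "(\<lambda>\<omega>. Some (X i \<omega>)) \<in> measurable M (add_point F)"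
    by (rule measurable_compose[OF X_meas[OF i] measurable_Some_add_point])
qed (simp add: space_add_point)

lemma Yv_meas: "Yv \<in> measurable M FY"
proof (rule measurable_restrict)
  fix i assume i: "i \<in> {1..n}"
  show "Y i \<in> measurable M (add_point F)"
    using masked_measurable[OF i S_count] by (rule measurable_cong[THEN iffD2, rotated]) (rule Y[OF i])
qed

lemma Zv_meas: "Zv \<in> measurable M FY"
proof (rule measurable_restrict)
  fix i assume i: "i \<in> {1..n}"
  show "Z i \<in> measurable M (add_point F)"
    using masked_measurable[OF i T_count] by (rule measurable_cong[THEN iffD2, rotated]) (rule Z[OF i])
qed

lemma Yv_eq: "\<omega> \<in> space M \<Longrightarrow> Yv \<omega> = mask (S \<omega>) (Xv \<omega>)"
  by (auto simp: mask_def Y fun_eq_iff)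

lemma Zv_eq: "\<omega> \<in> space M \<Longrightarrow> Zv \<omega> = mask (T \<omega>) (Xv \<omega>)"
  by (auto simp: mask_def Z fun_eq_iff)

lemma supp_mask: "s \<subseteq> {1..n} \<Longrightarrow> supp (mask s x) = s"
  by (auto simp: supp_def mask_def)

text \<open>The source of the coordinate hypotheses \<open>u_indep\<close> and
  \<open>v_indep\<close> of \<open>weighted_cov_PiM_le\<close>.\<close>

lemma mask_upd: "k \<notin> s \<Longrightarrow> mask s (x(k := y)) = mask s x"
  by (auto simp: mask_def fun_eq_iff)

lemma mask_meas: "mask s \<in> measurable FX FY"
  unfolding mask_def
proof (rule measurable_restrict)
  fix i assume i: "i \<in> {1..n}"
  show "(\<lambda>x. if i \<in> s then Some (x i) else None) \<in> measurable FX (add_point F)"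
    using measurable_compose[OF measurable_component_singleton[OF i] measurable_Some_add_point]
    by (cases "i \<in> s") (simp_all add: space_add_point)
qed

lemma supp_meas: "supp \<in> measurable FY (subset_space n)"
  unfolding supp_def[abs_def] by (rule measurable_support_add_point)

lemma ST_indep: "indep_elements M (count_space (Pow {1..n} \<times> Pow {1..n})) (\<lambda>\<omega>. (S \<omega>, T \<omega>)) FX Xv"
  using ST_X_indep by (simp add: pair_space_eq)

lemma S_indep: "indep_elements M (count_space (Pow {1..n})) S FX Xv"
proof -
  have "fst \<in> measurable (count_space (Pow {1..n} \<times> Pow {1..n})) (count_space (Pow {1..n}))"
    by auto
  from indep_elements_compose[OF ST_indep this measurable_ident] show ?thesis
    by simp
qed

lemma T_indep: "indep_elements M (count_space (Pow {1..n})) T FX Xv"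
proof -
  have "snd \<in> measurable (count_space (Pow {1..n} \<times> Pow {1..n})) (count_space (Pow {1..n}))"
    by auto
  from indep_elements_compose[OF ST_indep this measurable_ident] show ?thesis
    by simp
qed

text \<open>Independence of the \<open>X i\<close> becomes the factorization of their joint law,
  which opens the way to tensorization. The bound \<open>1 \<le> n\<close> makes the index set
  nonempty.\<close>

lemma PX_eq: "PX = (\<Pi>\<^sub>M i\<in>{1..n}. distr M F (X i))"
  using indep_vars_iff_distr_eq_PiM'[where I = "{1..n}" and M' = "\<lambda>_. F" and X = X] X_indep X_meas n by simp

lemma prob_space_PX: "prob_space PX"
  by (rule prob_space_distr[OF Xv_meas])

section \<open>Total covariance given the subsets, and the upper bound\<close>

lemma cov_ST:
  assumes h: "\<And>s. s \<subseteq> {1..n} \<Longrightarrow> sqint PX (h s)" and g: "\<And>t. t \<subseteq> {1..n} \<Longrightarrow> sqint PX (g t)"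
  shows "cov M (\<lambda>\<omega>. h (S \<omega>) (Xv \<omega>)) (\<lambda>\<omega>. g (T \<omega>) (Xv \<omega>)) =
    (\<Sum>s\<in>Pow {1..n}. \<Sum>t\<in>Pow {1..n}. prob {\<omega> \<in> space M. S \<omega> = s \<and> T \<omega> = t} * cov PX (h s) (g t)) +
    cov M (\<lambda>\<omega>. \<integral>x. h (S \<omega>) x \<partial>PX) (\<lambda>\<omega>. \<integral>x. g (T \<omega>) x \<partial>PX)"
  using cov_decouple[OF ST_indep, of "\<lambda>c. h (fst c)" "\<lambda>c. g (snd c)"] h g
  by (auto simp: sum.cartesian_product case_prod_beta prod_eq_iff)

text \<open>A variance of a function of \<open>S\<close> and \<open>X\<close> needs conditioning on
  \<open>S\<close> alone, so the weights are \<open>P(S = s)\<close>, as under the first root in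
  \<open>best_const\<close>.\<close>

lemma cov_S:
  assumes h: "\<And>s. s \<subseteq> {1..n} \<Longrightarrow> sqint PX (h s)"
  shows "cov M (\<lambda>\<omega>. h (S \<omega>) (Xv \<omega>)) (\<lambda>\<omega>. h (S \<omega>) (Xv \<omega>)) =
    (\<Sum>s\<in>Pow {1..n}. prob {\<omega> \<in> space M. S \<omega> = s} * cov PX (h s) (h s)) +
    cov M (\<lambda>\<omega>. \<integral>x. h (S \<omega>) x \<partial>PX) (\<lambda>\<omega>. \<integral>x. h (S \<omega>) x \<partial>PX)"
  by (rule cov_decouple[OF S_indep]) (auto intro: h)

lemma cov_T:
  assumes h: "\<And>s. s \<subseteq> {1..n} \<Longrightarrow> sqint PX (h s)"
  shows "cov M (\<lambda>\<omega>. h (T \<omega>) (Xv \<omega>)) (\<lambda>\<omega>. h (T \<omega>) (Xv \<omega>)) =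
    (\<Sum>s\<in>Pow {1..n}. prob {\<omega> \<in> space M. T \<omega> = s} * cov PX (h s) (h s)) +
    cov M (\<lambda>\<omega>. \<integral>x. h (T \<omega>) x \<partial>PX) (\<lambda>\<omega>. \<integral>x. h (T \<omega>) x \<partial>PX)"
  by (rule cov_decouple[OF T_indep]) (auto intro: h)

text \<open>Tensorization with the joint law of \<open>(S, T)\<close> as \<open>p\<close> and the
  two marginal laws as \<open>q\<close> and \<open>q'\<close> bounds the conditional covariances,
  because \<open>c\<close> dominates every \<open>best_const\<close>. The conditional means are
  bounded because \<open>c\<close> dominates the maximal correlation of \<open>S\<close> and
  \<open>T\<close>.\<close>

lemma cov_masked_le:
  fixes h g :: "nat set \<Rightarrow> (nat \<Rightarrow> 'a) \<Rightarrow> real"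
  assumes h: "\<And>s. s \<subseteq> {1..n} \<Longrightarrow> sqint PX (h s)" and g: "\<And>t. t \<subseteq> {1..n} \<Longrightarrow> sqint PX (g t)"
    and h_upd: "\<And>k s x y. k \<notin> s \<Longrightarrow> h s (x(k := y)) = h s x"
    and g_upd: "\<And>k t x y. k \<notin> t \<Longrightarrow> g t (x(k := y)) = g t x"
    and c: "max_corr M (subset_space n) S (subset_space n) T \<le> c"
      "\<And>j. j \<in> {1..n} \<Longrightarrow> best_const M n S T j \<le> c"
  shows "cov M (\<lambda>\<omega>. h (S \<omega>) (Xv \<omega>)) (\<lambda>\<omega>. g (T \<omega>) (Xv \<omega>)) \<le>
    c * sqrt (cov M (\<lambda>\<omega>. h (S \<omega>) (Xv \<omega>)) (\<lambda>\<omega>. h (S \<omega>) (Xv \<omega>))) *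
      sqrt (cov M (\<lambda>\<omega>. g (T \<omega>) (Xv \<omega>)) (\<lambda>\<omega>. g (T \<omega>) (Xv \<omega>)))"
proof -
  interpret PX: prob_space PX
    by (rule prob_space_PX)
  have c0: "0 \<le> c"
    using c(1) max_corr_nonneg[OF S_meas T_meas] by linarith
  define a where "a s = (\<integral>x. h s x \<partial>PX)" for s
  define b where "b t = (\<integral>x. g t x \<partial>PX)" for t
  let ?VS = "\<Sum>s\<in>Pow {1..n}. prob {\<omega> \<in> space M. S \<omega> = s} * cov PX (h s) (h s)"
  let ?VT = "\<Sum>t\<in>Pow {1..n}. prob {\<omega> \<in> space M. T \<omega> = t} * cov PX (g t) (g t)"
  let ?va = "cov M (\<lambda>\<omega>. a (S \<omega>)) (\<lambda>\<omega>. a (S \<omega>))" and ?vb = "cov M (\<lambda>\<omega>. b (T \<omega>)) (\<lambda>\<omega>. b (T \<omega>))"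
  have V0: "0 \<le> ?VS" "0 \<le> ?VT"
    using h g by (auto intro!: sum_nonneg mult_nonneg_nonneg PX.cov_nonneg)
  have v0: "0 \<le> ?va" "0 \<le> ?vb"
    by (intro cov_nonneg sqint_S sqint_T)+
  have "(\<Sum>s\<in>Pow {1..n}. \<Sum>t\<in>Pow {1..n}. prob {\<omega> \<in> space M. S \<omega> = s \<and> T \<omega> = t} *
      cov (\<Pi>\<^sub>M i\<in>{1..n}. distr M F (X i)) (h s) (g t)) \<le>
    c * (sqrt (\<Sum>s\<in>Pow {1..n}. prob {\<omega> \<in> space M. S \<omega> = s} *
          cov (\<Pi>\<^sub>M i\<in>{1..n}. distr M F (X i)) (h s) (h s)) *
        sqrt (\<Sum>t\<in>Pow {1..n}. prob {\<omega> \<in> space M. T \<omega> = t} *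
          cov (\<Pi>\<^sub>M i\<in>{1..n}. distr M F (X i)) (g t) (g t)))"
  proof (rule weighted_cov_PiM_le[where P = "\<lambda>k s. k \<in> s" and P' = "\<lambda>k t. k \<in> t"])
    fix k :: nat and \<alpha> \<beta> :: "nat set \<Rightarrow> real"
    assume k: "k \<in> {1..n}" and zero: "\<And>s. s \<in> Pow {1..n} \<Longrightarrow> k \<notin> s \<Longrightarrow> \<alpha> s = 0"
      "\<And>t. t \<in> Pow {1..n} \<Longrightarrow> k \<notin> t \<Longrightarrow> \<beta> t = 0"
    \<comment> \<open>Tensorization gives vanishing coefficients only for subsets of
      \<open>{1..n}\<close>, whereas \<open>admissible\<close> asks for it at every set; truncation
      repairs this without changing any value that enters the sums.\<close>
    define \<alpha>' where "\<alpha>' s = (if k \<in> s then \<alpha> s else 0)" for s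
    define \<beta>' where "\<beta>' s = (if k \<in> s then \<beta> s else 0)" for s
    have zero': "\<forall>s. k \<notin> s \<longrightarrow> \<alpha>' s = 0" "\<forall>t. k \<notin> t \<longrightarrow> \<beta>' t = 0"
      by (simp_all add: \<alpha>'_def \<beta>'_def)
    have [simp]: "\<alpha>' s = \<alpha> s" "\<beta>' s = \<beta> s" if "s \<in> Pow {1..n}" for s
      using zero that by (auto simp: \<alpha>'_def \<beta>'_def)
    have "expectation (\<lambda>\<omega>. \<alpha>' (S \<omega>) * \<beta>' (T \<omega>)) \<le> best_const M n S T k *
        (sqrt (expectation (\<lambda>\<omega>. (\<alpha>' (S \<omega>))\<^sup>2)) * sqrt (expectation (\<lambda>\<omega>. (\<beta>' (T \<omega>))\<^sup>2)))"
      using admissible_best_const[of k] zero' unfolding admissible_def by blast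
    also have "\<dots> \<le> c *
        (sqrt (expectation (\<lambda>\<omega>. (\<alpha>' (S \<omega>))\<^sup>2)) * sqrt (expectation (\<lambda>\<omega>. (\<beta>' (T \<omega>))\<^sup>2)))"
      by (intro mult_right_mono c(2) k) simp
    finally show "(\<Sum>s\<in>Pow {1..n}. \<Sum>t\<in>Pow {1..n}. prob {\<omega> \<in> space M. S \<omega> = s \<and> T \<omega> = t} * (\<alpha> s * \<beta> t)) \<le>
        c * (sqrt (\<Sum>s\<in>Pow {1..n}. prob {\<omega> \<in> space M. S \<omega> = s} * (\<alpha> s)\<^sup>2) *
          sqrt (\<Sum>t\<in>Pow {1..n}. prob {\<omega> \<in> space M. T \<omega> = t} * (\<beta> t)\<^sup>2))"
      by (simp add: expectation_ST[of "\<lambda>s t. \<alpha>' s * \<beta>' t"] expectation_S[of "\<lambda>s. (\<alpha>' s)\<^sup>2"]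
          expectation_T[of "\<lambda>s. (\<beta>' s)\<^sup>2"])
  qed (use c0 h g h_upd g_upd prob_space_distr[OF X_meas] in \<open>auto simp: PX_eq\<close>)
  then have 1: "(\<Sum>s\<in>Pow {1..n}. \<Sum>t\<in>Pow {1..n}. prob {\<omega> \<in> space M. S \<omega> = s \<and> T \<omega> = t} * cov PX (h s) (g t)) \<le>
      c * (sqrt ?VS * sqrt ?VT)"
    by (simp only: PX_eq)
  \<comment> \<open>The conditional means \<open>a\<close> and \<open>b\<close> are functions of
    \<open>S\<close> and \<open>T\<close> only, so they are test functions for the maximal
    correlation of the two sets.\<close>
  have "cov M (\<lambda>\<omega>. a (S \<omega>)) (\<lambda>\<omega>. b (T \<omega>)) \<le>
      max_corr M (subset_space n) S (subset_space n) T * sqrt ?va * sqrt ?vb"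
    by (rule cov_le_max_corr[OF S_meas T_meas])
       (auto simp: subset_space_def intro: sqint_S sqint_T)
  also have "\<dots> = max_corr M (subset_space n) S (subset_space n) T * (sqrt ?va * sqrt ?vb)"
    by simp
  also have "\<dots> \<le> c * (sqrt ?va * sqrt ?vb)"
    using v0 by (intro mult_right_mono c(1)) simp
  finally have "cov M (\<lambda>\<omega>. h (S \<omega>) (Xv \<omega>)) (\<lambda>\<omega>. g (T \<omega>) (Xv \<omega>)) \<le>
      c * (sqrt ?VS * sqrt ?VT + sqrt ?va * sqrt ?vb)"
    using 1 cov_ST[of h g, OF h g] by (simp add: a_def b_def distrib_left)
  also have "\<dots> \<le> c * (sqrt (?VS + ?va) * sqrt (?VT + ?vb))"
    by (intro mult_left_mono sqrt_mult_add_le V0 v0 c0)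
  finally show ?thesis
    using cov_S[of h, OF h] cov_T[of g, OF g] by (simp add: a_def b_def mult.assoc)
qed

lemma masked_representative:
  assumes U: "indep_elements M (count_space (Pow {1..n})) U FX Xv"
    and \<phi>: "\<phi> \<in> borel_measurable FY"
    and sq: "sqint M (\<lambda>\<omega>. \<phi> (mask (U \<omega>) (Xv \<omega>)))"
  obtains h where "\<And>s. s \<subseteq> {1..n} \<Longrightarrow> sqint PX (h s)"
    and "\<And>k s x y. k \<notin> s \<Longrightarrow> h s (x(k := y)) = h s x"
    and "AE \<omega> in M. \<phi> (mask (U \<omega>) (Xv \<omega>)) = h (U \<omega>) (Xv \<omega>)"
proof
  interpret PX: prob_space PX
    by (rule prob_space_PX)
  have U_meas[measurable]: "U \<in> measurable M (count_space (Pow {1..n}))"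
    using U by (simp add: indep_elements_def)
  \<comment> \<open>\<open>\<phi> \<circ> mask s\<close> need not be square integrable for a null value \<open>s\<close> of \<open>U\<close>\<close>
  define h where "h s x = (if prob {\<omega> \<in> space M. U \<omega> = s} = 0 then 0 else \<phi> (mask s x))" for s x
  show "sqint PX (h s)" if "s \<subseteq> {1..n}" for s
  proof (cases "prob {\<omega> \<in> space M. U \<omega> = s} = 0")
    case True
    then show ?thesis
      using PX.sqint_const[of 0] by (simp add: h_def[abs_def])
  next
    case False
    then show ?thesis
      using sqint_section[OF U, of "\<lambda>s x. \<phi> (mask s x)" s] that sq measurable_compose[OF mask_meas \<phi>]
      by (simp add: h_def[abs_def])
  qed
  show "h s (x(k := y)) = h s x" if "k \<notin> s" for k s x y
    using that by (simp add: h_def mask_upd)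
  \<comment> \<open>There are finitely many values \<open>s\<close>, so all null events
    \<open>U = s\<close> can be avoided at once. Elsewhere \<open>h (U \<omega>)\<close> agrees with
    \<open>\<phi>\<close> after masking.\<close>
  have "AE \<omega> in M. \<forall>s\<in>Pow {1..n}. prob {\<omega> \<in> space M. U \<omega> = s} = 0 \<longrightarrow> U \<omega> \<noteq> s"
  proof (rule AE_finite_allI)
    fix s assume "s \<in> Pow {1..n}"
    then have ev: "{\<omega> \<in> space M. U \<omega> = s} \<in> events"
      by simp
    show "AE \<omega> in M. prob {\<omega> \<in> space M. U \<omega> = s} = 0 \<longrightarrow> U \<omega> \<noteq> s"
    proof (cases "prob {\<omega> \<in> space M. U \<omega> = s} = 0")
      case True
      then have "AE \<omega> in M. \<omega> \<notin> {\<omega> \<in> space M. U \<omega> = s}"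
        using prob_eq_0[OF ev] by simp
      then show ?thesis
        using AE_space by eventually_elim simp
    qed simp
  qed simp
  then show "AE \<omega> in M. \<phi> (mask (U \<omega>) (Xv \<omega>)) = h (U \<omega>) (Xv \<omega>)"
    using AE_space
  proof eventually_elim
    case (elim \<omega>)
    then have "U \<omega> \<in> Pow {1..n}"
      using measurable_space[OF U_meas] by simp
    with elim have "prob {\<omega>' \<in> space M. U \<omega>' = U \<omega>} \<noteq> 0"
      by blast
    then show ?case
      by (simp add: h_def)
  qed
qed

lemma max_corr_masked_le:
  assumes c: "max_corr M (subset_space n) S (subset_space n) T \<le> c"
      "\<And>j. j \<in> {1..n} \<Longrightarrow> best_const M n S T j \<le> c"
  shows "max_corr M FY Yv FY Zv \<le> c"
proof (rule max_corr_least[OF Yv_meas Zv_meas])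
  show "0 \<le> c"
    using c(1) max_corr_nonneg[OF S_meas T_meas] by linarith
  fix \<phi> \<psi> :: "(nat \<Rightarrow> 'a option) \<Rightarrow> real"
  assume \<phi>: "\<phi> \<in> borel_measurable FY" and \<psi>: "\<psi> \<in> borel_measurable FY"
    and \<phi>_sq: "sqint M (\<lambda>\<omega>. \<phi> (Yv \<omega>))" and \<psi>_sq: "sqint M (\<lambda>\<omega>. \<psi> (Zv \<omega>))"
  have "sqint M (\<lambda>\<omega>. \<phi> (mask (S \<omega>) (Xv \<omega>)))"
    using \<phi>_sq by (rule sqint_cong[THEN iffD1, rotated]) (simp add: Yv_eq)
  from masked_representative[OF S_indep \<phi> this] obtain h
    where h: "\<And>s. s \<subseteq> {1..n} \<Longrightarrow> sqint PX (h s)"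
      and h_upd: "\<And>k s x y. k \<notin> s \<Longrightarrow> h s (x(k := y)) = h s x"
      and h_AE: "AE \<omega> in M. \<phi> (mask (S \<omega>) (Xv \<omega>)) = h (S \<omega>) (Xv \<omega>)"
    by blast
  have "sqint M (\<lambda>\<omega>. \<psi> (mask (T \<omega>) (Xv \<omega>)))"
    using \<psi>_sq by (rule sqint_cong[THEN iffD1, rotated]) (simp add: Zv_eq)
  from masked_representative[OF T_indep \<psi> this] obtain g
    where g: "\<And>s. s \<subseteq> {1..n} \<Longrightarrow> sqint PX (g s)"
      and g_upd: "\<And>k s x y. k \<notin> s \<Longrightarrow> g s (x(k := y)) = g s x"
      and g_AE: "AE \<omega> in M. \<psi> (mask (T \<omega>) (Xv \<omega>)) = g (T \<omega>) (Xv \<omega>)"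
    by blast
  have hS: "sqint M (\<lambda>\<omega>. h (S \<omega>) (Xv \<omega>))" and gT: "sqint M (\<lambda>\<omega>. g (T \<omega>) (Xv \<omega>))"
    by (rule sqint_decouple[OF S_indep] sqint_decouple[OF T_indep]; simp add: h g)+
  have \<phi>_AE: "AE \<omega> in M. \<phi> (Yv \<omega>) = h (S \<omega>) (Xv \<omega>)"
    using h_AE AE_space by eventually_elim (simp add: Yv_eq)
  have \<psi>_AE: "AE \<omega> in M. \<psi> (Zv \<omega>) = g (T \<omega>) (Xv \<omega>)"
    using g_AE AE_space by eventually_elim (simp add: Zv_eq)
  note meas = sqint_measurable[OF \<phi>_sq] sqint_measurable[OF \<psi>_sq] sqint_measurable[OF hS] sqint_measurable[OF gT]
  have "cov M (\<lambda>\<omega>. \<phi> (Yv \<omega>)) (\<lambda>\<omega>. \<psi> (Zv \<omega>)) = cov M (\<lambda>\<omega>. h (S \<omega>) (Xv \<omega>)) (\<lambda>\<omega>. g (T \<omega>) (Xv \<omega>))"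
    "cov M (\<lambda>\<omega>. \<phi> (Yv \<omega>)) (\<lambda>\<omega>. \<phi> (Yv \<omega>)) = cov M (\<lambda>\<omega>. h (S \<omega>) (Xv \<omega>)) (\<lambda>\<omega>. h (S \<omega>) (Xv \<omega>))"
    "cov M (\<lambda>\<omega>. \<psi> (Zv \<omega>)) (\<lambda>\<omega>. \<psi> (Zv \<omega>)) = cov M (\<lambda>\<omega>. g (T \<omega>) (Xv \<omega>)) (\<lambda>\<omega>. g (T \<omega>) (Xv \<omega>))"
    by (rule cov_cong_AE[OF _ _ _ _ \<phi>_AE \<psi>_AE] cov_cong_AE[OF _ _ _ _ \<phi>_AE \<phi>_AE]
        cov_cong_AE[OF _ _ _ _ \<psi>_AE \<psi>_AE]; rule meas)+
  then show "cov M (\<lambda>\<omega>. \<phi> (Yv \<omega>)) (\<lambda>\<omega>. \<psi> (Zv \<omega>)) \<le>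
      c * sqrt (cov M (\<lambda>\<omega>. \<phi> (Yv \<omega>)) (\<lambda>\<omega>. \<phi> (Yv \<omega>))) * sqrt (cov M (\<lambda>\<omega>. \<psi> (Zv \<omega>)) (\<lambda>\<omega>. \<psi> (Zv \<omega>)))"
    using cov_masked_le[of h g, OF h g h_upd g_upd c] by simp
qed

section \<open>The lower bounds\<close>

lemma max_corr_subsets_le: "max_corr M (subset_space n) S (subset_space n) T \<le> max_corr M FY Yv FY Zv"
proof (rule max_corr_least[OF S_meas T_meas max_corr_nonneg[OF Yv_meas Zv_meas]])
  fix \<phi> \<psi> :: "nat set \<Rightarrow> real"
  assume \<phi>: "\<phi> \<in> borel_measurable (subset_space n)" and \<psi>: "\<psi> \<in> borel_measurable (subset_space n)"
  have Y_eq: "\<phi> (supp (Yv \<omega>)) = \<phi> (S \<omega>)" if "\<omega> \<in> space M" for \<omega>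
    using that by (simp add: Yv_eq supp_mask S_subset)
  have Z_eq: "\<psi> (supp (Zv \<omega>)) = \<psi> (T \<omega>)" if "\<omega> \<in> space M" for \<omega>
    using that by (simp add: Zv_eq supp_mask T_subset)
  have sq: "sqint M (\<lambda>\<omega>. \<phi> (supp (Yv \<omega>)))" "sqint M (\<lambda>\<omega>. \<psi> (supp (Zv \<omega>)))"
    using sqint_S[of \<phi>] sqint_T[of \<psi>] Y_eq Z_eq by (simp_all cong: sqint_cong)
  have "cov M (\<lambda>\<omega>. \<phi> (supp (Yv \<omega>))) (\<lambda>\<omega>. \<psi> (supp (Zv \<omega>))) \<le> max_corr M FY Yv FY Zv *
      sqrt (cov M (\<lambda>\<omega>. \<phi> (supp (Yv \<omega>))) (\<lambda>\<omega>. \<phi> (supp (Yv \<omega>)))) *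
      sqrt (cov M (\<lambda>\<omega>. \<psi> (supp (Zv \<omega>))) (\<lambda>\<omega>. \<psi> (supp (Zv \<omega>))))"
    using measurable_compose[OF supp_meas \<phi>] measurable_compose[OF supp_meas \<psi>] sq
    by (intro cov_le_max_corr[OF Yv_meas Zv_meas])
  then show "cov M (\<lambda>\<omega>. \<phi> (S \<omega>)) (\<lambda>\<omega>. \<psi> (T \<omega>)) \<le> max_corr M FY Yv FY Zv *
      sqrt (cov M (\<lambda>\<omega>. \<phi> (S \<omega>)) (\<lambda>\<omega>. \<phi> (S \<omega>))) * sqrt (cov M (\<lambda>\<omega>. \<psi> (T \<omega>)) (\<lambda>\<omega>. \<psi> (T \<omega>)))"
    using Y_eq Z_eq by (simp cong: cov_cong)
qed

text \<open>For centered \<open>\<xi>\<close> the conditional means of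
  \<open>\<alpha> (S \<omega>) * \<xi> (X j \<omega>)\<close> and its counterpart for
  \<open>T\<close> are 0. Of the total covariance only the weighted sums remain, and these are the
  moments in \<open>admissible\<close> times the variance \<open>v\<close>.\<close>

lemma best_const_le_max_corr:
  assumes j: "j \<in> {1..n}"
  shows "best_const M n S T j \<le> max_corr M FY Yv FY Zv"
proof (rule best_const_le)
  interpret PX: prob_space PX
    by (rule prob_space_PX)
  let ?R = "max_corr M FY Yv FY Zv"
  obtain f where f[measurable]: "f \<in> borel_measurable F" and f_sq: "sqint M (\<lambda>\<omega>. f (X j \<omega>))" and f_pos: "0 < cov M (\<lambda>\<omega>. f (X j \<omega>)) (\<lambda>\<omega>. f (X j \<omega>))"
    using nondegenerateD[OF X_meas[OF j] X_nondegenerate[OF j]] by blast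
  define v where "v = cov M (\<lambda>\<omega>. f (X j \<omega>)) (\<lambda>\<omega>. f (X j \<omega>))"
  define \<xi> where "\<xi> a = f a - expectation (\<lambda>\<omega>. f (X j \<omega>))" for a
  have \<xi>[measurable]: "\<xi> \<in> borel_measurable F"
    by (simp add: \<xi>_def[abs_def])
  have \<xi>_sq_M: "sqint M (\<lambda>\<omega>. \<xi> (X j \<omega>))"
    unfolding \<xi>_def by (rule sqint_diff[OF f_sq sqint_const])
  have \<xi>j[measurable]: "(\<lambda>x. \<xi> (x j)) \<in> borel_measurable FX"
    by (rule measurable_compose[OF measurable_component_singleton[OF j] \<xi>])
  have \<xi>_sq: "sqint PX (\<lambda>x. \<xi> (x j))"
    using \<xi>_sq_M j by (simp add: sqint_distr_iff)
  have mean0: "(\<integral>x. \<xi> (x j) \<partial>PX) = 0"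
    using j sqint_integrable[OF f_sq] by (simp add: integral_distr \<xi>_def prob_space)
  have "cov PX (\<lambda>x. \<xi> (x j)) (\<lambda>x. \<xi> (x j)) = (\<integral>x. (\<xi> (x j))\<^sup>2 \<partial>PX)"
    by (simp add: cov_def mean0 power2_eq_square)
  also have "\<dots> = v"
    using variance_eq_cov[OF f_sq] j by (simp add: integral_distr \<xi>_def[symmetric] v_def)
  finally have cov_\<xi>: "cov PX (\<lambda>x. \<xi> (x j)) (\<lambda>x. \<xi> (x j)) = v" .
  have cov_c: "cov PX (\<lambda>x. c * \<xi> (x j)) (\<lambda>x. d * \<xi> (x j)) = c * d * v" for c d
  proof -
    have "(\<integral>x. (c * \<xi> (x j)) * (d * \<xi> (x j)) \<partial>PX) = (\<integral>x. (c * d) * (\<xi> (x j) * \<xi> (x j)) \<partial>PX)"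
      by (simp add: mult_ac)
    then show ?thesis
      unfolding cov_\<xi>[symmetric] by (simp add: cov_def mean0)
  qed
  \<comment> \<open>on the masked vector \<open>Y\<close> this takes the value \<open>\<alpha> S * \<xi> (X j)\<close>, and likewise for \<open>Z\<close> and \<open>T\<close>\<close>
  define lift where "lift \<alpha> y = \<alpha> (supp y) * case_option 0 \<xi> (y j)" for \<alpha> :: "nat set \<Rightarrow> real" and y
  have lift_meas: "lift \<alpha> \<in> borel_measurable FY" for \<alpha>
    unfolding lift_def
  proof (rule borel_measurable_times)
    show "(\<lambda>y. \<alpha> (supp y)) \<in> borel_measurable FY"
      by (rule measurable_compose[OF supp_meas]) (simp add: subset_space_def)
    show "(\<lambda>y. case_option 0 \<xi> (y j)) \<in> borel_measurable FY"
      by (rule measurable_compose[OF measurable_component_singleton[OF j] measurable_case_option_add_point[OF \<xi>]])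
        simp
  qed
  \<comment> \<open>If \<open>j\<close> lies in \<open>s\<close>, the masked vector shows
    \<open>x j\<close>; otherwise both sides are 0, the right one because
    \<open>\<alpha> s = 0\<close>.\<close>
  have lift_mask: "lift \<alpha> (mask s x) = \<alpha> s * \<xi> (x j)" if "s \<subseteq> {1..n}" "\<forall>s. j \<notin> s \<longrightarrow> \<alpha> s = 0" for \<alpha> s x
    using that j by (simp add: lift_def supp_mask) (simp add: mask_def)
  show "admissible j ?R"
    unfolding admissible_def
  proof (intro conjI allI impI max_corr_nonneg[OF Yv_meas Zv_meas])
    fix \<alpha> \<beta> :: "nat set \<Rightarrow> real"
    assume \<alpha>: "\<forall>s. j \<notin> s \<longrightarrow> \<alpha> s = 0" and \<beta>: "\<forall>t. j \<notin> t \<longrightarrow> \<beta> t = 0"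
    have Y_eq: "lift \<alpha> (Yv \<omega>) = \<alpha> (S \<omega>) * \<xi> (Xv \<omega> j)" if "\<omega> \<in> space M" for \<omega>
      using that by (simp only: Yv_eq lift_mask[OF S_subset \<alpha>])
    have Z_eq: "lift \<beta> (Zv \<omega>) = \<beta> (T \<omega>) * \<xi> (Xv \<omega> j)" if "\<omega> \<in> space M" for \<omega>
      using that by (simp only: Zv_eq lift_mask[OF T_subset \<beta>])
    have sq: "sqint PX (\<lambda>x. c * \<xi> (x j))" for c
      by (rule sqint_cmult[OF \<xi>_sq])
    have "sqint M (\<lambda>\<omega>. \<alpha> (S \<omega>) * \<xi> (Xv \<omega> j))" "sqint M (\<lambda>\<omega>. \<beta> (T \<omega>) * \<xi> (Xv \<omega> j))"
      using sqint_decouple[OF S_indep, of "\<lambda>s x. \<alpha> s * \<xi> (x j)"]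
        sqint_decouple[OF T_indep, of "\<lambda>s x. \<beta> s * \<xi> (x j)"] sq by simp_all
    then have sqYZ: "sqint M (\<lambda>\<omega>. lift \<alpha> (Yv \<omega>))" "sqint M (\<lambda>\<omega>. lift \<beta> (Zv \<omega>))"
      using sqint_cong[of M "\<lambda>\<omega>. lift \<alpha> (Yv \<omega>)" "\<lambda>\<omega>. \<alpha> (S \<omega>) * \<xi> (Xv \<omega> j)", OF Y_eq]
        sqint_cong[of M "\<lambda>\<omega>. lift \<beta> (Zv \<omega>)" "\<lambda>\<omega>. \<beta> (T \<omega>) * \<xi> (Xv \<omega> j)", OF Z_eq] by blast+
    have zero: "cov M (\<lambda>\<omega>. 0) (\<lambda>\<omega>. 0) = 0"
      by (simp add: cov_def)
    have YZ: "cov M (\<lambda>\<omega>. lift \<alpha> (Yv \<omega>)) (\<lambda>\<omega>. lift \<beta> (Zv \<omega>)) = expectation (\<lambda>\<omega>. \<alpha> (S \<omega>) * \<beta> (T \<omega>)) * v"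
    proof -
      have "cov M (\<lambda>\<omega>. lift \<alpha> (Yv \<omega>)) (\<lambda>\<omega>. lift \<beta> (Zv \<omega>)) =
          cov M (\<lambda>\<omega>. \<alpha> (S \<omega>) * \<xi> (Xv \<omega> j)) (\<lambda>\<omega>. \<beta> (T \<omega>) * \<xi> (Xv \<omega> j))"
        by (rule cov_cong[OF Y_eq Z_eq])
      also have "\<dots> = (\<Sum>s\<in>Pow {1..n}. \<Sum>t\<in>Pow {1..n}.
          prob {\<omega> \<in> space M. S \<omega> = s \<and> T \<omega> = t} * (\<alpha> s * \<beta> t * v))"
        using cov_ST[of "\<lambda>s x. \<alpha> s * \<xi> (x j)" "\<lambda>t x. \<beta> t * \<xi> (x j)", OF sq sq]
        unfolding cov_c by (simp only: integral_mult_right_zero mean0 mult_zero_right zero add_0_right)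
      also have "\<dots> = expectation (\<lambda>\<omega>. \<alpha> (S \<omega>) * \<beta> (T \<omega>)) * v"
        by (simp add: expectation_ST[of "\<lambda>s t. \<alpha> s * \<beta> t"] sum_distrib_right mult.assoc)
      finally show ?thesis .
    qed
    have YY: "cov M (\<lambda>\<omega>. lift \<alpha> (Yv \<omega>)) (\<lambda>\<omega>. lift \<alpha> (Yv \<omega>)) = expectation (\<lambda>\<omega>. (\<alpha> (S \<omega>))\<^sup>2) * v"
    proof -
      have "cov M (\<lambda>\<omega>. lift \<alpha> (Yv \<omega>)) (\<lambda>\<omega>. lift \<alpha> (Yv \<omega>)) =
          cov M (\<lambda>\<omega>. \<alpha> (S \<omega>) * \<xi> (Xv \<omega> j)) (\<lambda>\<omega>. \<alpha> (S \<omega>) * \<xi> (Xv \<omega> j))"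
        by (rule cov_cong[OF Y_eq Y_eq])
      also have "\<dots> = (\<Sum>s\<in>Pow {1..n}. prob {\<omega> \<in> space M. S \<omega> = s} * (\<alpha> s * \<alpha> s * v))"
        using cov_S[of "\<lambda>s x. \<alpha> s * \<xi> (x j)", OF sq]
        unfolding cov_c by (simp only: integral_mult_right_zero mean0 mult_zero_right zero add_0_right)
      also have "\<dots> = expectation (\<lambda>\<omega>. (\<alpha> (S \<omega>))\<^sup>2) * v"
        unfolding expectation_S[of "\<lambda>s. (\<alpha> s)\<^sup>2"]
        by (simp add: sum_distrib_right mult.assoc power2_eq_square)
      finally show ?thesis .
    qed
    have ZZ: "cov M (\<lambda>\<omega>. lift \<beta> (Zv \<omega>)) (\<lambda>\<omega>. lift \<beta> (Zv \<omega>)) = expectation (\<lambda>\<omega>. (\<beta> (T \<omega>))\<^sup>2) * v"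
    proof -
      have "cov M (\<lambda>\<omega>. lift \<beta> (Zv \<omega>)) (\<lambda>\<omega>. lift \<beta> (Zv \<omega>)) =
          cov M (\<lambda>\<omega>. \<beta> (T \<omega>) * \<xi> (Xv \<omega> j)) (\<lambda>\<omega>. \<beta> (T \<omega>) * \<xi> (Xv \<omega> j))"
        by (rule cov_cong[OF Z_eq Z_eq])
      also have "\<dots> = (\<Sum>s\<in>Pow {1..n}. prob {\<omega> \<in> space M. T \<omega> = s} * (\<beta> s * \<beta> s * v))"
        using cov_T[of "\<lambda>s x. \<beta> s * \<xi> (x j)", OF sq]
        unfolding cov_c by (simp only: integral_mult_right_zero mean0 mult_zero_right zero add_0_right)
      also have "\<dots> = expectation (\<lambda>\<omega>. (\<beta> (T \<omega>))\<^sup>2) * v"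
        unfolding expectation_T[of "\<lambda>s. (\<beta> s)\<^sup>2"]
        by (simp add: sum_distrib_right mult.assoc power2_eq_square)
      finally show ?thesis .
    qed
    have v: "0 < v"
      using f_pos by (simp add: v_def)
    have "expectation (\<lambda>\<omega>. \<alpha> (S \<omega>) * \<beta> (T \<omega>)) * v \<le>
        ?R * sqrt (expectation (\<lambda>\<omega>. (\<alpha> (S \<omega>))\<^sup>2) * v) * sqrt (expectation (\<lambda>\<omega>. (\<beta> (T \<omega>))\<^sup>2) * v)"
      using cov_le_max_corr[OF Yv_meas Zv_meas lift_meas[of \<alpha>] _ lift_meas[of \<beta>], OF sqYZ]
      unfolding YZ YY ZZ .
    \<comment> \<open>Each root contributes \<open>sqrt v\<close>, so the same positive factor
      \<open>v\<close> stands on both sides and cancels.\<close>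
    also have "\<dots> = ?R * (sqrt (expectation (\<lambda>\<omega>. (\<alpha> (S \<omega>))\<^sup>2)) * sqrt (expectation (\<lambda>\<omega>. (\<beta> (T \<omega>))\<^sup>2))) * v"
      using v by (simp add: real_sqrt_mult)
    finally show "expectation (\<lambda>\<omega>. \<alpha> (S \<omega>) * \<beta> (T \<omega>)) \<le>
        ?R * (sqrt (expectation (\<lambda>\<omega>. (\<alpha> (S \<omega>))\<^sup>2)) * sqrt (expectation (\<lambda>\<omega>. (\<beta> (T \<omega>))\<^sup>2)))"
      using v by (simp only: mult_le_cancel_right_pos)
  qed
qed

lemma max_corr_masked:
  "max_corr M FY Yv FY Zv = max (max_corr M (subset_space n) S (subset_space n) T)
     (Max {best_const M n S T j | j. j \<in> {1..n}})" (is "_ = max ?c (Max ?B)")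
proof (rule antisym)
  have B: "?B = best_const M n S T ` {1..n}"
    by auto
  have "finite ?B" "?B \<noteq> {}"
    using n by (auto simp: B)
  then show "max_corr M FY Yv FY Zv \<le> max ?c (Max ?B)"
    by (intro max_corr_masked_le) (auto intro!: max.coboundedI2 Max_ge)
  show "max ?c (Max ?B) \<le> max_corr M FY Yv FY Zv"
    using \<open>finite ?B\<close> \<open>?B \<noteq> {}\<close>
    by (auto simp: max_corr_subsets_le best_const_le_max_corr)
qed

end

theorem theorem1p5:
  fixes M :: "'w measure" and F :: "'a measure" and n :: nat
    and X :: "nat \<Rightarrow> 'w \<Rightarrow> 'a" and S T :: "'w \<Rightarrow> nat set"
    and Y Z :: "nat \<Rightarrow> 'w \<Rightarrow> 'a option"
  assumes "prob_space M"
    and "n \<ge> 1"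
    and "prob_space.indep_vars M (\<lambda>_. F) X {1..n}"
    and "\<And>i. i \<in> {1..n} \<Longrightarrow> \<not> degenerate M F (X i)"
    and "S \<in> measurable M (subset_space n)"
    and "T \<in> measurable M (subset_space n)"
    and "indep_elements M (subset_space n \<Otimes>\<^sub>M subset_space n) (\<lambda>\<omega>. (S \<omega>, T \<omega>))
           (\<Pi>\<^sub>M i\<in>{1..n}. F) (\<lambda>\<omega>. \<lambda>i\<in>{1..n}. X i \<omega>)"
    and "\<And>i \<omega>. i \<in> {1..n} \<Longrightarrow> \<omega> \<in> space M \<Longrightarrow>
           Y i \<omega> = (if i \<in> S \<omega> then Some (X i \<omega>) else None)"
    and "\<And>i \<omega>. i \<in> {1..n} \<Longrightarrow> \<omega> \<in> space M \<Longrightarrow>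
           Z i \<omega> = (if i \<in> T \<omega> then Some (X i \<omega>) else None)"
  shows "max_corr M
           (\<Pi>\<^sub>M i\<in>{1..n}. add_point F) (\<lambda>\<omega>. \<lambda>i\<in>{1..n}. Y i \<omega>)
           (\<Pi>\<^sub>M i\<in>{1..n}. add_point F) (\<lambda>\<omega>. \<lambda>i\<in>{1..n}. Z i \<omega>)
         = max (max_corr M (subset_space n) S (subset_space n) T)
               (Max {best_const M n S T j | j. j \<in> {1..n}})
       \<and> (prob_space.indep_var M (subset_space n) S (subset_space n) T \<longrightarrow>
           max_corr M (subset_space n) S (subset_space n) T = 0 \<and>
           (\<forall>j\<in>{1..n}. best_const M n S T j =
              sqrt (measure M {\<omega> \<in> space M. j \<in> S \<omega>} * measure M {\<omega> \<in> space M. j \<in> T \<omega>})))"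
proof -
  interpret prob_space M
    by fact
  interpret masked_vector M n S T F X Y Z
    by unfold_locales (use assms in auto)
  show ?thesis
    using max_corr_masked max_corr_indep best_const_indep by blast
qed

end
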